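(* Let $s, t \geq 2$ be integers, let $G$ be a $\mathcal{J}_{s,t}$-minor-free graph, and let $(T, \mathcal{W})$ be a tree-decomposition of $G$. Then $G$ has a partition of $\mathcal{W}$-width at most $t-1$ and treewidth at most $s$.
   Context: All graphs are finite, simple and undirected. $\mathcal{J}_{s,t}$ is the class of graphs whose vertex-set has a partition $A \cup B$ with $|A| = s$, $|B| = t$, $A$ a clique, every vertex of $A$ adjacent to every vertex of $B$, and $G[B]$ connected. A graph is $\mathcal{J}_{s,t}$-minor-free if it contains no graph of $\mathcal{J}_{s,t}$ as a minor. A tree-decomposition $(T,\mathcal{W})$, $\mathcal{W} = (W_x : x \in V(T))$, consists of a tree $T$ and bags $W_x \subseteq V(G)$ such that for each vertex $v$ the nodes whose bags contain $v$ induce a non-empty connected subtree of $T$, and each edge has both ends in some bag. A partition of $G$ is a graph $H$ whose vertices (called parts) are sets of vertices of $G$, such that each vertex of $G$ lies in exactly one part, and for every edge $vw$ of $G$ with $v \in X \in V(H)$, $w \in Y \in V(H)$, either $X = Y$ or $XY \in E(H)$. The treewidth of a partition $H$ is $\mathrm{tw}(H)$. The $\mathcal{W}$-width of a set $S \subseteq V(G)$ is the minimum number of bags of $\mathcal{W}$ whose union contains $S$; the $\mathcal{W}$-width of a partition $H$ is the maximum $\mathcal{W}$-width of a part of $H$. *)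

theory Defs
  imports
    "Graph_Theory.Digraph_Component"
    "Graph_Theory.Digraph_Isomorphism"
begin

text \<open>
  A finite simple undirected graph is a \<^typ>\<open>'a pair_pre_digraph\<close> satisfying \<^const>\<open>pair_graph\<close>:
  finite, loop-free, and with a symmetric set of arcs, so that an edge \<open>uv\<close> is the
  pair of arcs \<open>(u,v)\<close>, \<open>(v,u)\<close>.  The null graph is a graph, but is not \<^const>\<open>connected\<close>.
\<close>

subsection \<open>Minors\<close>

text \<open>The edge \<open>uv\<close> is contracted onto \<open>u\<close>; the resulting loops and parallel edges vanish.\<close>

definition contract_edge :: "'a pair_pre_digraph \<Rightarrow> 'a \<Rightarrow> 'a \<Rightarrow> 'a pair_pre_digraph" where
  "contract_edge G u v =
     \<lparr> pverts = pverts G - {v},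
       parcs = map_prod (id(v := u)) (id(v := u)) ` parcs G - Id \<rparr>"

definition edge_contraction :: "'a pair_pre_digraph \<Rightarrow> 'a pair_pre_digraph \<Rightarrow> bool" where
  "edge_contraction G G' \<longleftrightarrow> (\<exists>u v. (u, v) \<in> parcs G \<and> G' = contract_edge G u v)"

definition minor :: "'b pair_pre_digraph \<Rightarrow> 'a pair_pre_digraph \<Rightarrow> bool" where
  "minor H G \<longleftrightarrow>
     (\<exists>G0 G1. pair_graph G0 \<and> subgraph (with_proj G0) (with_proj G) \<and>
        edge_contraction\<^sup>*\<^sup>* G0 G1 \<and> digraph_iso (with_proj G1) (with_proj H))"

definition J_class :: "nat \<Rightarrow> nat \<Rightarrow> 'a pair_pre_digraph set" where
  "J_class s t =
     {H. pair_graph H \<and>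
        (\<exists>A B. A \<union> B = pverts H \<and> A \<inter> B = {} \<and> card A = s \<and> card B = t \<and>
           (\<forall>u\<in>A. \<forall>v\<in>A. u \<noteq> v \<longrightarrow> (u, v) \<in> parcs H) \<and>
           (\<forall>a\<in>A. \<forall>b\<in>B. (a, b) \<in> parcs H) \<and>
           connected (with_proj H \<restriction> B))}"

text \<open>
  Every finite graph is isomorphic to one on natural numbers and \<^const>\<open>minor\<close> is
  invariant under isomorphism, so it suffices to let \<open>H\<close> range over the latter.
\<close>

definition J_minor_free :: "nat \<Rightarrow> nat \<Rightarrow> 'a pair_pre_digraph \<Rightarrow> bool" where
  "J_minor_free s t G \<longleftrightarrow> (\<forall>H :: nat pair_pre_digraph. H \<in> J_class s t \<longrightarrow> \<not> minor H G)"


subsection \<open>Tree-decompositions and treewidth\<close>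

text \<open>
  The library's \<^const>\<open>tree\<close> is not usable here: in a symmetric digraph every edge yields a
  directed cycle of length 2.  Cycles of the undirected graph are those of length at least 3.
\<close>

definition graph_tree :: "'b pair_pre_digraph \<Rightarrow> bool" where
  "graph_tree T \<longleftrightarrow>
     pair_graph T \<and> connected (with_proj T) \<and>
     \<not> (\<exists>p. pre_digraph.cycle (with_proj T) p \<and> 3 \<le> length p)"

definition tree_decomposition ::
  "'a pair_pre_digraph \<Rightarrow> 'b pair_pre_digraph \<Rightarrow> ('b \<Rightarrow> 'a set) \<Rightarrow> bool" where
  "tree_decomposition G T W \<longleftrightarrow>
     graph_tree T \<and>
     (\<forall>x\<in>pverts T. W x \<subseteq> pverts G) \<and>
     (\<forall>v\<in>pverts G. connected (with_proj T \<restriction> {x \<in> pverts T. v \<in> W x})) \<and>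
     (\<forall>(u, v)\<in>parcs G. \<exists>x\<in>pverts T. u \<in> W x \<and> v \<in> W x)"

definition decomposition_width :: "'b pair_pre_digraph \<Rightarrow> ('b \<Rightarrow> 'a set) \<Rightarrow> nat" where
  "decomposition_width T W = Max ((\<lambda>x. card (W x)) ` pverts T) - 1"

text \<open>
  Decomposition trees are finite, so taking their nodes to be natural numbers loses nothing.
  The null graph gets treewidth 0.
\<close>

definition treewidth :: "'a pair_pre_digraph \<Rightarrow> nat" where
  "treewidth G =
     (LEAST k. \<exists>(T :: nat pair_pre_digraph) W.
        tree_decomposition G T W \<and> decomposition_width T W = k)"


subsection \<open>Partitions\<close>

definition graph_partition :: "'a pair_pre_digraph \<Rightarrow> 'a set pair_pre_digraph \<Rightarrow> bool" where
  "graph_partition G H \<longleftrightarrow>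
     pair_graph H \<and>
     (\<forall>X\<in>pverts H. X \<subseteq> pverts G) \<and>
     (\<forall>v\<in>pverts G. \<exists>!X. X \<in> pverts H \<and> v \<in> X) \<and>
     (\<forall>(v, w)\<in>parcs G. \<forall>X\<in>pverts H. \<forall>Y\<in>pverts H.
        v \<in> X \<and> w \<in> Y \<longrightarrow> X = Y \<or> (X, Y) \<in> parcs H)"

definition set_bag_width :: "'b pair_pre_digraph \<Rightarrow> ('b \<Rightarrow> 'a set) \<Rightarrow> 'a set \<Rightarrow> nat" where
  "set_bag_width T W S = (LEAST n. \<exists>N \<subseteq> pverts T. card N = n \<and> S \<subseteq> (\<Union>x\<in>N. W x))"

text \<open>The \<open>0\<close> only matters for a partition without parts, whose width is thereby 0.\<close>

definition partition_bag_width ::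
  "'b pair_pre_digraph \<Rightarrow> ('b \<Rightarrow> 'a set) \<Rightarrow> 'a set pair_pre_digraph \<Rightarrow> nat" where
  "partition_bag_width T W H = Max (insert 0 (set_bag_width T W ` pverts H))"

end

theory Submission
  imports Defs
begin

text \<open>
  Parts are created one at a time, each inside a component \<open>C\<close> of the graph induced by the vertices not
  yet covered.  The parts with neighbours in \<open>C\<close> number at most \<open>s\<close>, lie in a common bag of the
  tree-decomposition of the partition built so far, and extend to the branch sets of a clique
  outside \<open>C\<close>.  Call a subset of \<open>C\<close> colourful if it is adjacent to all these parts.  If there are \<open>s\<close>
  of them, then \<open>t\<close> disjoint connected colourful sets would give a minor in \<open>J_class s t\<close>, so \<open>t - 1\<close> bags
  meet every connected colourful set.  If there are fewer, a lowest node of the tree below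
  which a connected colourful set exists yields a subset of one bag such that every
  colourful component \<open>D\<close> it leaves has its neighbours in \<open>C\<close> inside a connected colourful set avoiding
  \<open>D\<close>.  In both cases a minimal such subset of \<open>C\<close> is the new part: minimality makes the
  clique model extend to every component left over, and a component that is not
  colourful has lost one of the old neighbouring parts in exchange for the new one.
\<close>

section \<open>Connected vertex sets\<close>

text \<open>
  Connectedness is stated through closed subsets rather than through walks, so that most
  connectivity arguments reduce to set reasoning.
\<close>

definition conn :: "('a \<times> 'a) set \<Rightarrow> 'a set \<Rightarrow> bool" where
  "conn E S \<longleftrightarrow> S \<noteq> {} \<and>
     (\<forall>A\<subseteq>S. A \<noteq> {} \<longrightarrow> (\<forall>a\<in>A. \<forall>b\<in>S. (a, b) \<in> E \<longrightarrow> b \<in> A) \<longrightarrow> A = S)"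

definition component_of :: "('a \<times> 'a) set \<Rightarrow> 'a set \<Rightarrow> 'a set \<Rightarrow> bool" where
  "component_of E U D \<longleftrightarrow> D \<subseteq> U \<and> conn E D \<and> (\<forall>a\<in>D. \<forall>b\<in>U. (a, b) \<in> E \<longrightarrow> b \<in> D)"

lemma connI:
  assumes "S \<noteq> {}"
    and "\<And>A. \<lbrakk>A \<subseteq> S; A \<noteq> {}; \<And>a b. \<lbrakk>a \<in> A; b \<in> S; (a, b) \<in> E\<rbrakk> \<Longrightarrow> b \<in> A\<rbrakk> \<Longrightarrow> S \<subseteq> A"
  shows "conn E S"
  unfolding conn_def
proof (intro conjI allI impI)
  show "S \<noteq> {}" by fact
  fix A assume "A \<subseteq> S" "A \<noteq> {}" "\<forall>a\<in>A. \<forall>b\<in>S. (a, b) \<in> E \<longrightarrow> b \<in> A"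
  with assms(2)[of A] show "A = S" by blast
qed

text \<open>An induction principle: a property that holds somewhere in \<open>S\<close> and is
  passed along the edges inside \<open>S\<close> holds on all of \<open>S\<close>. Since
  \<open>A\<close> may stick out of \<open>S\<close>, it can be whatever set the argument at hand
  suggests.\<close>

lemma connD:
  assumes "conn E S" "A \<inter> S \<noteq> {}" "\<And>a b. \<lbrakk>a \<in> A; a \<in> S; b \<in> S; (a, b) \<in> E\<rbrakk> \<Longrightarrow> b \<in> A"
  shows "S \<subseteq> A"
proof -
  have "A \<inter> S = S"
    using assms(1)[unfolded conn_def, THEN conjunct2, rule_format, of "A \<inter> S"] assms(2,3) by blast
  then show ?thesis by blast
qed

lemma conn_nonempty: "conn E S \<Longrightarrow> S \<noteq> {}"
  by (simp add: conn_def)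

lemma conn_iff_rtrancl:
  "conn E S \<longleftrightarrow> S \<noteq> {} \<and> (\<forall>x\<in>S. \<forall>y\<in>S. (x, y) \<in> (E \<inter> S \<times> S)\<^sup>*)"
proof (intro iffI conjI ballI)
  assume c: "conn E S"
  then show "S \<noteq> {}" by (rule conn_nonempty)
  fix x y assume x: "x \<in> S" and y: "y \<in> S"
  have "S \<subseteq> {y. (x, y) \<in> (E \<inter> S \<times> S)\<^sup>*}"
    by (rule connD[OF c]) (use x in \<open>auto intro: rtrancl_into_rtrancl\<close>)
  with y show "(x, y) \<in> (E \<inter> S \<times> S)\<^sup>*" by blast
next
  assume r: "S \<noteq> {} \<and> (\<forall>x\<in>S. \<forall>y\<in>S. (x, y) \<in> (E \<inter> S \<times> S)\<^sup>*)"
  show "conn E S"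
  proof (rule connI)
    show "S \<noteq> {}" using r by simp
    fix A assume A: "A \<subseteq> S" "A \<noteq> {}" and cl: "\<And>a b. \<lbrakk>a \<in> A; b \<in> S; (a, b) \<in> E\<rbrakk> \<Longrightarrow> b \<in> A"
    then obtain a where a: "a \<in> A" by blast
    have "b \<in> A" if "(a, b) \<in> (E \<inter> S \<times> S)\<^sup>*" for b
      using that by (induction rule: rtrancl_induct) (use a cl in auto)
    then show "S \<subseteq> A" using r a A by blast
  qed
qed

lemma conn_singleton: "conn E {x}"
  by (rule connI) auto

text \<open>A closed set meeting one side swallows it and then crosses over the pair
  \<open>a\<close>, \<open>b\<close>. Symmetry lets the crossing go either way, and
  \<open>a = b\<close> covers overlapping sets.\<close>

lemma conn_Un:
  assumes "sym E" "conn E A" "conn E B" "a \<in> A" "b \<in> B" "(a, b) \<in> E \<or> a = b"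
  shows "conn E (A \<union> B)"
proof (rule connI)
  show "A \<union> B \<noteq> {}" using assms(4) by blast
  fix Z assume Z: "Z \<subseteq> A \<union> B" "Z \<noteq> {}"
    and cl: "\<And>a b. \<lbrakk>a \<in> Z; b \<in> A \<union> B; (a, b) \<in> E\<rbrakk> \<Longrightarrow> b \<in> Z"
  have sa: "A \<subseteq> Z" if "Z \<inter> A \<noteq> {}"
    by (rule connD[OF assms(2) that]) (use cl in auto)
  have sb: "B \<subseteq> Z" if "Z \<inter> B \<noteq> {}"
    by (rule connD[OF assms(3) that]) (use cl in auto)
  have "(b, a) \<in> E \<or> a = b" using assms(1,6) by (auto dest: symD)
  then have "a \<in> Z \<longleftrightarrow> b \<in> Z" using assms(4-6) cl by blast
  then show "A \<union> B \<subseteq> Z" using sa sb Z assms(4,5) by blast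
qed

lemma conn_insert:
  assumes "sym E" "conn E A" "a \<in> A" "(a, x) \<in> E"
  shows "conn E (insert x A)"
  using conn_Un[OF assms(1,2) conn_singleton assms(3), of x x] assms(4) by simp

lemma conn_edge_out:
  assumes "conn E S" "A \<subset> S" "A \<noteq> {}"
  obtains a b where "a \<in> A" "b \<in> S - A" "(a, b) \<in> E"
  using connD[OF assms(1), of A] assms(2,3) by blast

lemma conn_cong:
  assumes "\<And>x y. \<lbrakk>x \<in> S; y \<in> S\<rbrakk> \<Longrightarrow> (x, y) \<in> E \<longleftrightarrow> (x, y) \<in> F"
  shows "conn E S \<longleftrightarrow> conn F S"
proof -
  have "(\<forall>a\<in>A. \<forall>b\<in>S. (a, b) \<in> E \<longrightarrow> b \<in> A) \<longleftrightarrow> (\<forall>a\<in>A. \<forall>b\<in>S. (a, b) \<in> F \<longrightarrow> b \<in> A)"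
    if "A \<subseteq> S" for A
    using that assms by (meson subsetD)
  then show ?thesis unfolding conn_def by simp
qed

text \<open>Preimages of closed sets are closed. Edges that \<open>f\<close> collapses demand
  nothing of \<open>F\<close>, which makes this the tool for contractions.\<close>

lemma conn_image:
  assumes "conn E S" "\<And>x y. \<lbrakk>x \<in> S; y \<in> S; (x, y) \<in> E; f x \<noteq> f y\<rbrakk> \<Longrightarrow> (f x, f y) \<in> F"
  shows "conn F (f ` S)"
proof (rule connI)
  show "f ` S \<noteq> {}" using assms(1) conn_nonempty by blast
  fix A assume A: "A \<subseteq> f ` S" "A \<noteq> {}"
    and cl: "\<And>a b. \<lbrakk>a \<in> A; b \<in> f ` S; (a, b) \<in> F\<rbrakk> \<Longrightarrow> b \<in> A"
  have "S \<subseteq> f -` A"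
  proof (rule connD[OF assms(1)])
    show "f -` A \<inter> S \<noteq> {}" using A by blast
    show "b \<in> f -` A" if "a \<in> f -` A" "a \<in> S" "b \<in> S" "(a, b) \<in> E" for a b
      using that assms(2)[of a b] cl[of "f a" "f b"] by (cases "f a = f b") auto
  qed
  then show "f ` S \<subseteq> A" by blast
qed

lemma component_ofD:
  assumes "component_of E U D"
  shows "D \<subseteq> U" "conn E D" "\<And>a b. \<lbrakk>a \<in> D; b \<in> U; (a, b) \<in> E\<rbrakk> \<Longrightarrow> b \<in> D"
  using assms unfolding component_of_def by blast+

text \<open>The component is the set of vertices reachable from \<open>v\<close> inside
  \<open>U\<close>. By symmetry of \<open>E\<close> a closed subset of it reaches back to
  \<open>v\<close>, and from there everything.\<close>

lemma component_of_exists: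
  assumes "sym E" "v \<in> U"
  obtains D where "component_of E U D" "v \<in> D"
proof
  let ?R = "E \<inter> U \<times> U"
  let ?D = "{w. (v, w) \<in> ?R\<^sup>*}"
  have DU: "?D \<subseteq> U" using assms(2) by (auto elim: rtranclE)
  have symR: "sym (?R\<^sup>*)" using assms(1) by (intro sym_rtrancl) (auto simp: sym_def)
  have "conn E ?D"
  proof (rule connI)
    fix A assume A: "A \<subseteq> ?D" "A \<noteq> {}" and cl: "\<And>a b. \<lbrakk>a \<in> A; b \<in> ?D; (a, b) \<in> E\<rbrakk> \<Longrightarrow> b \<in> A"
    then obtain a where a: "a \<in> A" by blast
    have *: "b \<in> A" if "(a, b) \<in> ?R\<^sup>*" for b
      using that
    proof (induction rule: rtrancl_induct)
      case (step y z)
      then have "z \<in> ?D" using A(1) by (auto intro: rtrancl_into_rtrancl)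
      with step show ?case using cl by blast
    qed (use a in simp)
    have "(a, v) \<in> ?R\<^sup>*" using a A(1) symR by (auto dest: symD)
    then show "?D \<subseteq> A" using * by (auto intro: rtrancl_trans)
  qed auto
  then show "component_of E U ?D"
    unfolding component_of_def using DU by (auto intro: rtrancl_into_rtrancl)
  show "v \<in> ?D" by simp
qed

lemma conn_subset_component:
  assumes "component_of E U D" "conn E S" "S \<subseteq> U" "S \<inter> D \<noteq> {}"
  shows "S \<subseteq> D"
  by (rule connD[OF assms(2)]) (use assms(1,3,4) in \<open>auto simp: component_of_def\<close>)

section \<open>Library graphs as sets of pairs\<close>

text \<open>The library symmetrises the arcs before asking for reachability. The arcs of
  \<open>G\<close> are symmetric already, so this is reachability by arcs within
  \<open>S\<close>.\<close>

lemma conn_induce_subgraph_iff: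
  assumes "pair_graph G" "S \<subseteq> pverts G"
  shows "connected (with_proj G \<restriction> S) \<longleftrightarrow> conn (parcs G) S"
proof -
  interpret pair_graph G by fact
  let ?F = "\<Union>e\<in>arcs (with_proj G \<restriction> S). {(tail G e, head G e), (head G e, tail G e)}"
  have F: "?F = parcs G \<inter> S \<times> S"
    using arcs_symmetric by (fastforce simp: induce_subgraph_def)
  have "reachable (with_proj (mk_symmetric (with_proj G \<restriction> S))) u v \<longleftrightarrow> (u, v) \<in> (parcs G \<inter> S \<times> S)\<^sup>*"
    if "u \<in> S" for u v
  proof -
    have "reachable (with_proj (mk_symmetric (with_proj G \<restriction> S))) u v \<longleftrightarrow>
        (u, v) \<in> rtrancl_on S (parcs G \<inter> S \<times> S)"
      unfolding reachable_def mk_symmetric_def arcs_ends_def arc_to_ends_def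
      using F by (simp add: with_proj_def)
    also have "\<dots> \<longleftrightarrow> (u, v) \<in> (parcs G \<inter> S \<times> S)\<^sup>*"
    proof
      assume "(u, v) \<in> (parcs G \<inter> S \<times> S)\<^sup>*"
      then show "(u, v) \<in> rtrancl_on S (parcs G \<inter> S \<times> S)"
      proof (induction rule: rtrancl_induct)
        case base then show ?case using that by (rule rtrancl_on_refl)
      next
        case (step y z)
        then show ?case by (auto intro: rtrancl_on_into_rtrancl_on)
      qed
    next
      assume "(u, v) \<in> rtrancl_on S (parcs G \<inter> S \<times> S)"
      then show "(u, v) \<in> (parcs G \<inter> S \<times> S)\<^sup>*"
        by (induction rule: rtrancl_on.induct) (auto intro: rtrancl_into_rtrancl)
    qed
    finally show ?thesis .
  qed
  then show ?thesis
    unfolding connected_def strongly_connected_def conn_iff_rtrancl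
    by (auto simp: mk_symmetric_def)
qed

text \<open>Replaces the tower of locales by four set conditions that can be checked directly for
  each graph constructed later.\<close>

lemma pair_graph_iff:
  "pair_graph G \<longleftrightarrow> finite (pverts G) \<and> parcs G \<subseteq> pverts G \<times> pverts G \<and> sym (parcs G) \<and> irrefl (parcs G)"
proof
  assume G: "pair_graph G"
  have "a \<in> pverts G \<and> b \<in> pverts G \<and> (b, a) \<in> parcs G \<and> a \<noteq> b" if "(a, b) \<in> parcs G" for a b
    using that pair_wf_digraph.in_arcsD1[of G a b] pair_wf_digraph.in_arcsD2[of G a b]
      pair_sym_digraph.arcs_symmetric[of G a b] pair_loopfree_digraph.no_loops'[of G a b] G
    by (simp add: pair_graph_def pair_digraph_def pair_pseudo_graph_def pair_fin_digraph_def)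
  then show "finite (pverts G) \<and> parcs G \<subseteq> pverts G \<times> pverts G \<and> sym (parcs G) \<and> irrefl (parcs G)"
    using pair_fin_digraph.pair_finite_verts[of G] G
    by (auto simp: pair_graph_def pair_digraph_def sym_def irrefl_def)
next
  assume *: "finite (pverts G) \<and> parcs G \<subseteq> pverts G \<times> pverts G \<and> sym (parcs G) \<and> irrefl (parcs G)"
  then have "finite (parcs G)" by (meson finite_SigmaI finite_subset)
  moreover have "arcs_ends (with_proj G) = parcs G"
    by (auto simp: arcs_ends_def arc_to_ends_def)
  ultimately show "pair_graph G"
    using * by unfold_locales (auto simp: irrefl_def symmetric_def)
qed

lemma conn_graph_iff:
  assumes "pair_graph G"
  shows "connected (with_proj G) \<longleftrightarrow> conn (parcs G) (pverts G)"
proof -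
  have "{e \<in> parcs G. fst e \<in> pverts G \<and> snd e \<in> pverts G} = parcs G"
    using assms unfolding pair_graph_iff by force
  then have "with_proj G \<restriction> pverts G = with_proj G"
    by (simp add: induce_subgraph_def with_proj_def)
  then show ?thesis using conn_induce_subgraph_iff[OF assms, of "pverts G"] by simp
qed

section \<open>Trees\<close>

text \<open>Acyclicity without walks: outside vertices attach to a connected set by at most one edge.\<close>

definition single_attach :: "('a \<times> 'a) set \<Rightarrow> bool" where
  "single_attach E \<longleftrightarrow>
     (\<forall>S z y y'. conn E S \<longrightarrow> z \<notin> S \<longrightarrow> y \<in> S \<longrightarrow> y' \<in> S \<longrightarrow> (z, y) \<in> E \<longrightarrow> (z, y') \<in> E \<longrightarrow> y = y')"

section \<open>Cycles and single attachment\<close>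

text \<open>Serves to shorten walks: when a step is prepended from a vertex that the path visits
  already, the path is restarted at that vertex instead.\<close>

lemma pawalk_suffix_path:
  assumes "pcas u p y" "x \<in> set (pawalk_verts u p)" "distinct (pawalk_verts u p)"
  shows "\<exists>q. pcas x q y \<and> set q \<subseteq> set p \<and> set (pawalk_verts x q) \<subseteq> set (pawalk_verts u p) \<and>
    distinct (pawalk_verts x q)"
  using assms
proof (induction p arbitrary: u)
  case Nil
  then show ?case by (intro exI[of _ "[]"]) auto
next
  case (Cons e p)
  show ?case
  proof (cases "x = u")
    case True
    then show ?thesis using Cons.prems by (intro exI[of _ "e # p"]) auto
  next
    case False
    then obtain q where "pcas x q y \<and> set q \<subseteq> set p \<and>
        set (pawalk_verts x q) \<subseteq> set (pawalk_verts (snd e) p) \<and> distinct (pawalk_verts x q)"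
      using Cons.IH[of "snd e"] Cons.prems by auto
    then show ?thesis by auto
  qed
qed

lemma rtrancl_path:
  assumes "(x, y) \<in> (E \<inter> S \<times> S)\<^sup>*" "y \<in> S"
  shows "\<exists>p. pcas x p y \<and> set p \<subseteq> E \<and> set (pawalk_verts x p) \<subseteq> S \<and> distinct (pawalk_verts x p)"
  using assms(1)
proof (induction rule: converse_rtrancl_induct)
  case base
  then show ?case using assms(2) by (intro exI[of _ "[]"]) auto
next
  case (step x z)
  then obtain p where p: "pcas z p y" "set p \<subseteq> E" "set (pawalk_verts z p) \<subseteq> S" "distinct (pawalk_verts z p)"
    by blast
  show ?case
  proof (cases "x \<in> set (pawalk_verts z p)")
    case True
    from pawalk_suffix_path[OF p(1) True p(4)] p(2,3) show ?thesis by blast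
  next
    case False
    then show ?thesis using p step.hyps by (intro exI[of _ "(x, z) # p"]) auto
  qed
qed

lemma conn_pawalk_verts:
  assumes "sym E" "pcas u p v" "set p \<subseteq> E"
  shows "conn E (set (pawalk_verts u p))"
  using assms(2,3)
proof (induction p arbitrary: u)
  case Nil
  then show ?case by (simp add: conn_singleton)
next
  case (Cons e p)
  have "snd e \<in> set (pawalk_verts (snd e) p)" by (cases p) (use Cons.prems in auto)
  moreover have "(snd e, fst e) \<in> E" using Cons.prems assms(1) by (cases e) (auto dest: symD)
  ultimately show ?case using Cons.IH[of "snd e"] Cons.prems conn_insert[OF assms(1)] by auto
qed

lemma pcas_append:
  "pcas u (p @ q) w \<longleftrightarrow> pcas u p (last (pawalk_verts u p)) \<and> pcas (last (pawalk_verts u p)) q w"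
proof (induction p arbitrary: u)
  case (Cons e p)
  have "pawalk_verts (snd e) p \<noteq> []" by (cases p) auto
  with Cons show ?case by auto
qed simp

lemma pcas_last: "pcas u p v \<Longrightarrow> last (pawalk_verts u p) = v \<and> pawalk_verts u p \<noteq> []"
  by (induction p arbitrary: u) auto

lemma pawalk_verts_snoc:
  assumes "pcas u p a"
  shows "pawalk_verts u (p @ [(a, b)]) = pawalk_verts u p @ [b]"
  using assms by (induction p arbitrary: u) auto

lemma pair_cycle_iff:
  "pre_digraph.cycle (with_proj T) p \<longleftrightarrow>
     (\<exists>u\<in>pverts T. set p \<subseteq> parcs T \<and> pcas u p u \<and> distinct (tl (pawalk_verts u p)) \<and> p \<noteq> [])"
  by (auto simp: pre_digraph.cycle_def pre_digraph.awalk_def cas_with_proj_eq awalk_verts_with_proj_eq)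

text \<open>Deleting a vertex \<open>u\<close> from a cycle of length at least 3 leaves a path with
  at least two vertices, a connected set to which \<open>u\<close> attaches at both ends.
  Conversely, a path inside \<open>S\<close> between two distinct attachment points of
  \<open>z\<close> closes up through \<open>z\<close> to a cycle.\<close>

lemma graph_tree_iff:
  "graph_tree T \<longleftrightarrow> pair_graph T \<and> conn (parcs T) (pverts T) \<and> single_attach (parcs T)"
proof (cases "pair_graph T")
  case True
  let ?E = "parcs T"
  have symE: "sym ?E" and sub: "?E \<subseteq> pverts T \<times> pverts T"
    using True unfolding pair_graph_iff by auto
  have "(\<exists>p. pre_digraph.cycle (with_proj T) p \<and> 3 \<le> length p) \<longleftrightarrow> \<not> single_attach ?E"
  proof
    assume "\<exists>p. pre_digraph.cycle (with_proj T) p \<and> 3 \<le> length p"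
    then obtain u p where p: "set p \<subseteq> ?E" "pcas u p u" "distinct (tl (pawalk_verts u p))" "3 \<le> length p"
      unfolding pair_cycle_iff by blast
    then obtain e p' where pe: "p = e # p'" "2 \<le> length p'" by (cases p) auto
    then obtain q d where q: "p' = q @ [d]" "q \<noteq> []" by (cases p' rule: rev_cases) force+
    obtain y y' where ed: "e = (u, y)" "d = (y', u)" and cq: "pcas y q y'"
      using p(2) pe(1) q(1) by (cases e, cases d) (auto simp: pcas_append)
    have v: "pawalk_verts y p' = pawalk_verts y q @ [u]"
      using pawalk_verts_snoc[OF cq] q(1) ed by simp
    then have u: "u \<notin> set (pawalk_verts y q)" and dq: "distinct (pawalk_verts y q)"
      using p(3) pe(1) ed by auto
    have "y \<in> set (pawalk_verts y q)" using q(2) cq by (cases q) auto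
    moreover have "y' \<in> set (pawalk_verts y q)" using pcas_last[OF cq] last_in_set by metis
    moreover have "y \<noteq> y'"
    proof
      assume "y = y'"
      moreover obtain f q' where "q = f # q'" using q(2) by (cases q) auto
      ultimately show False using cq dq pcas_last[of "snd f" q' y'] last_in_set
        by (metis distinct.simps(2) pawalk_verts.simps(2) pcas.simps(2))
    qed
    moreover have "conn ?E (set (pawalk_verts y q))"
      by (rule conn_pawalk_verts[OF symE cq]) (use p(1) pe(1) q(1) in auto)
    moreover have "(u, y) \<in> ?E" "(u, y') \<in> ?E"
      using p(1) pe(1) q(1) ed symE by (auto dest: symD)
    ultimately show "\<not> single_attach ?E" unfolding single_attach_def using u by blast
  next
    assume "\<not> single_attach ?E"
    then obtain S z y y' where *: "conn ?E S" "z \<notin> S" "y \<in> S" "y' \<in> S" "(z, y) \<in> ?E" "(z, y') \<in> ?E" "y \<noteq> y'"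
      unfolding single_attach_def by blast
    then have "(y, y') \<in> (?E \<inter> S \<times> S)\<^sup>*" unfolding conn_iff_rtrancl by blast
    from rtrancl_path[OF this] * obtain p where
      p: "pcas y p y'" "set p \<subseteq> ?E" "set (pawalk_verts y p) \<subseteq> S" "distinct (pawalk_verts y p)" by blast
    let ?c = "(z, y) # p @ [(y', z)]"
    have "p \<noteq> []" using p(1) *(7) by auto
    then have "3 \<le> length ?c" by (cases p) auto
    moreover have "pcas z ?c z" using p(1) pcas_last[OF p(1)] by (simp add: pcas_append)
    moreover have "distinct (tl (pawalk_verts z ?c))"
      using p(3,4) *(2) pawalk_verts_snoc[OF p(1)] by auto
    moreover have "set ?c \<subseteq> ?E" using p(2) * symE by (auto dest: symD)
    moreover have "z \<in> pverts T" using * sub by auto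
    ultimately show "\<exists>p. pre_digraph.cycle (with_proj T) p \<and> 3 \<le> length p"
      unfolding pair_cycle_iff by blast
  qed
  then show ?thesis unfolding graph_tree_def conn_graph_iff[OF True] by blast
qed (simp add: graph_tree_def)

section \<open>Adding a leaf to a tree\<close>

text \<open>The only neighbour of \<open>l\<close> is \<open>x\<close>. If \<open>l\<close> lies
  outside \<open>S\<close>, it can attach to \<open>S\<close> only at \<open>x\<close>; if it lies
  in \<open>S\<close>, it can be cut off without disconnecting the rest, unless \<open>S\<close> is
  just \<open>{l}\<close>.\<close>

lemma single_attach_add_leaf:
  assumes sa: "single_attach E" and E: "E \<subseteq> V \<times> V" and x: "x \<in> V" and l: "l \<notin> V"
  shows "single_attach (E \<union> {(x, l), (l, x)})" (is "single_attach ?F")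
  unfolding single_attach_def
proof (intro allI impI)
  fix S z y y'
  assume S: "conn ?F S" "z \<notin> S" "y \<in> S" "y' \<in> S" "(z, y) \<in> ?F" "(z, y') \<in> ?F"
  show "y = y'"
  proof (cases "l \<in> S")
    case False
    then have "conn E S" using S(1) conn_cong[of S ?F E] by auto
    moreover have "z \<noteq> l \<Longrightarrow> (z, y) \<in> E \<and> (z, y') \<in> E" using S False by auto
    moreover have "z = l \<Longrightarrow> y = x \<and> y' = x" using S(5,6) E l by auto
    ultimately show ?thesis using sa S(2-4) unfolding single_attach_def by blast
  next
    case lS: True
    show ?thesis
    proof (cases "x \<in> S")
      case True
      \<comment> \<open>Moving \<open>l\<close> to \<open>x\<close> collapses the only edge at
        \<open>l\<close>, so \<open>S - {l}\<close> is the image of a connected set.\<close>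
      have "conn E ((\<lambda>v. if v = l then x else v) ` S)"
        by (rule conn_image[OF S(1)]) (use E l in auto)
      also have "(\<lambda>v. if v = l then x else v) ` S = S - {l}" using True lS x l by auto
      finally have "conn E (S - {l})" .
      moreover have "(z, y) \<in> E" "(z, y') \<in> E" using S(2,5,6) True lS by auto
      moreover have "y \<noteq> l" "y' \<noteq> l" using calculation(2,3) E l by auto
      ultimately show ?thesis using sa S(2-4) unfolding single_attach_def by blast
    next
      case False
      have "S \<subseteq> {l}" by (rule connD[OF S(1)]) (use lS False E l in auto)
      then show ?thesis using S(3,4) by blast
    qed
  qed
qed

lemma graph_tree_add_leaf:
  assumes T: "graph_tree T" and x: "x \<in> pverts T" and l: "l \<notin> pverts T"
  shows "graph_tree \<lparr>pverts = insert l (pverts T), parcs = parcs T \<union> {(x, l), (l, x)}\<rparr>"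
proof -
  let ?F = "parcs T \<union> {(x, l), (l, x)}"
  have pg: "pair_graph T" "conn (parcs T) (pverts T)" "single_attach (parcs T)"
    using T unfolding graph_tree_iff by auto
  have sub: "parcs T \<subseteq> pverts T \<times> pverts T" "sym (parcs T)" "irrefl (parcs T)" "finite (pverts T)"
    using pg(1) unfolding pair_graph_iff by auto
  have symF: "sym ?F" using sub(2) by (auto simp: sym_def)
  have "conn ?F (pverts T)" using pg(2) conn_cong[of "pverts T" ?F "parcs T"] l by auto
  then have "conn ?F (insert l (pverts T))" by (rule conn_insert[OF symF _ x]) simp
  moreover have "irrefl ?F" using sub(3) x l by (auto simp: irrefl_def)
  ultimately show ?thesis
    unfolding graph_tree_iff pair_graph_iff
    using single_attach_add_leaf[OF pg(3) sub(1) x l] sub symF x by auto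
qed

section \<open>Minors from branch sets\<close>

text \<open>Vertices are identified by sending them to representatives of the same type, so that
  contracting an edge is the case \<open>id(v := u)\<close> and quotients compose.\<close>

definition quotient_graph :: "'a pair_pre_digraph \<Rightarrow> ('a \<Rightarrow> 'a) \<Rightarrow> 'a pair_pre_digraph" where
  "quotient_graph G f = \<lparr>pverts = f ` pverts G, parcs = map_prod f f ` parcs G - Id\<rparr>"

lemma pair_graph_quotient:
  assumes "pair_graph G"
  shows "pair_graph (quotient_graph G f)"
  using assms unfolding pair_graph_iff quotient_graph_def
  by (auto simp: sym_def irrefl_def image_iff) (metis map_prod_simp)

lemma contract_edge_eq_quotient:
  assumes "u \<in> pverts G" "v \<in> pverts G" "u \<noteq> v"
  shows "contract_edge G u v = quotient_graph G (id(v := u))"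
  using assms by (auto simp: contract_edge_def quotient_graph_def)

text \<open>Induction on the number of vertices. If \<open>f\<close> moves a vertex to
  \<open>r\<close>, the fibre of \<open>r\<close> is connected and has further vertices, so some
  edge joins \<open>r\<close> to another \<open>v\<close> in it. Contracting \<open>v\<close> onto
  \<open>r\<close> keeps the fibres connected and does not change the quotient by
  \<open>f\<close>.\<close>

lemma edge_contraction_quotient:
  assumes "pair_graph G"
    and "\<And>v. v \<in> pverts G \<Longrightarrow> f v \<in> pverts G \<and> f (f v) = f v"
    and "\<And>v. v \<in> pverts G \<Longrightarrow> conn (parcs G) {w \<in> pverts G. f w = f v}"
  shows "edge_contraction\<^sup>*\<^sup>* G (quotient_graph G f)"
  using assms
proof (induction "card (pverts G)" arbitrary: G rule: less_induct)
  case less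
  note G = less.prems(1) and f = less.prems(2) and fib = less.prems(3)
  have Gp: "finite (pverts G)" "parcs G \<subseteq> pverts G \<times> pverts G" "irrefl (parcs G)"
    using G unfolding pair_graph_iff by auto
  show ?case
  proof (cases "\<forall>v\<in>pverts G. f v = v")
    case True
    have "map_prod f f e = e" if "e \<in> parcs G" for e
      using that Gp(2) True by (cases e) auto
    then have "map_prod f f ` parcs G = parcs G" by simp
    moreover have "parcs G - Id = parcs G" using Gp(3) by (auto simp: irrefl_def)
    ultimately have "quotient_graph G f = G" using True by (simp add: quotient_graph_def)
    then show ?thesis by simp
  next
    case False
    then obtain w where w: "w \<in> pverts G" "f w \<noteq> w" by blast
    define r where "r = f w"
    have r: "r \<in> pverts G" "f r = r" "r \<noteq> w" using f w by (auto simp: r_def)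
    let ?S = "{v \<in> pverts G. f v = r}"
    have cS: "conn (parcs G) ?S" using fib[OF w(1)] by (simp add: r_def)
    have "w \<in> ?S" "r \<in> ?S" using r w(1) by (auto simp: r_def)
    then have "{r} \<subset> ?S" using r(3) by (metis insert_subset empty_subsetI psubsetI singletonD)
    then obtain r' v where "r' \<in> {r}" "v \<in> ?S - {r}" "(r', v) \<in> parcs G"
      by (rule conn_edge_out[OF cS]) simp
    then have v: "v \<in> ?S" "v \<noteq> r" "(r, v) \<in> parcs G" by simp_all
    let ?g = "id(v := r)"
    let ?G = "quotient_graph G ?g"
    have vV: "v \<in> pverts G" "f v = r" using v by auto
    have fg: "f (?g x) = f x" for x using vV r by auto
    have verts: "pverts ?G = pverts G - {v}" using r v by (auto simp: quotient_graph_def)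
    have step: "edge_contraction G ?G"
      unfolding edge_contraction_def using contract_edge_eq_quotient[OF r(1) vV(1)] v by metis
    have fnv: "f x \<noteq> v" if "x \<in> pverts G" for x using f[OF that] v by auto
    have "edge_contraction\<^sup>*\<^sup>* ?G (quotient_graph ?G f)"
    proof (rule less.hyps)
      show "card (pverts ?G) < card (pverts G)"
        unfolding verts using Gp(1) vV by (simp add: card_gt_0_iff) (metis card_gt_0_iff diff_Suc_less empty_iff)
      show "pair_graph ?G" using G by (rule pair_graph_quotient)
      show "f x \<in> pverts ?G \<and> f (f x) = f x" if "x \<in> pverts ?G" for x
        using that f[of x] fnv[of x] unfolding verts by auto
      show "conn (parcs ?G) {y \<in> pverts ?G. f y = f x}" if "x \<in> pverts ?G" for x
      proof -
        have x: "x \<in> pverts G" using that verts by blast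
        have "conn (parcs ?G) (?g ` {y \<in> pverts G. f y = f x})"
          by (rule conn_image[OF fib[OF x]]) (force simp: quotient_graph_def)
        also have "?g ` {y \<in> pverts G. f y = f x} = {y \<in> pverts ?G. f y = f x}"
        proof -
          have "?g ` {y \<in> pverts G. f y = f x} \<subseteq> {y \<in> pverts ?G. f y = f x}"
            using vV r(2) by (auto simp: quotient_graph_def)
          moreover have "y \<in> ?g ` {y \<in> pverts G. f y = f x}" if "y \<in> pverts ?G" "f y = f x" for y
            using that verts by (intro image_eqI[of _ _ y]) auto
          ultimately show ?thesis by blast
        qed
        finally show ?thesis .
      qed
    qed
    moreover have "quotient_graph ?G f = quotient_graph G f"
    proof -
      have fgc: "f \<circ> ?g = f" using fg by auto
      have "map_prod f f ` (map_prod ?g ?g ` parcs G - Id) - Id = map_prod f f ` map_prod ?g ?g ` parcs G - Id"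
        by auto
      also have "\<dots> = map_prod f f ` parcs G - Id"
        by (simp only: image_comp map_prod.comp fgc)
      finally have "map_prod f f ` (map_prod ?g ?g ` parcs G - Id) - Id = map_prod f f ` parcs G - Id" .
      moreover have "f ` ?g ` pverts G = f ` pverts G" by (simp only: image_comp fgc)
      ultimately show ?thesis unfolding quotient_graph_def by simp
    qed
    ultimately show ?thesis using step by (metis converse_rtranclp_into_rtranclp)
  qed
qed

text \<open>Serves twice: with numbers as indices it is the minor given by branch sets, and with
  \<open>B\<close> the identity on a family of parts it is the graph of the partition.\<close>

definition branch_graph :: "('a \<times> 'a) set \<Rightarrow> 'c set \<Rightarrow> ('c \<Rightarrow> 'a set) \<Rightarrow> 'c pair_pre_digraph" where
  "branch_graph E I B =
     \<lparr>pverts = I, parcs = {(i, j). i \<in> I \<and> j \<in> I \<and> i \<noteq> j \<and> (\<exists>a\<in>B i. \<exists>b\<in>B j. (a, b) \<in> E)}\<rparr>"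

lemma pair_graph_branch_graph:
  assumes "finite I" "sym E"
  shows "pair_graph (branch_graph E I B)"
  using assms unfolding pair_graph_iff branch_graph_def by (auto simp: sym_def irrefl_def)

text \<open>Restrict \<open>G\<close> to the union of the branch sets and contract each of them to a
  chosen representative \<open>rep i\<close>. The index map \<open>idx\<close> is then an
  isomorphism from the contracted graph to the branch graph.\<close>

lemma minor_branch_graph:
  assumes G: "pair_graph G" and I: "finite I"
    and B: "\<And>i. i \<in> I \<Longrightarrow> B i \<subseteq> pverts G \<and> conn (parcs G) (B i)"
    and dis: "\<And>i j. \<lbrakk>i \<in> I; j \<in> I; i \<noteq> j\<rbrakk> \<Longrightarrow> B i \<inter> B j = {}"
  shows "minor (branch_graph (parcs G) I B) G"
proof -
  let ?E = "parcs G"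
  have Gp: "finite (pverts G)" "?E \<subseteq> pverts G \<times> pverts G" "sym ?E" "irrefl ?E"
    using G unfolding pair_graph_iff by auto
  let ?U = "\<Union>i\<in>I. B i"
  define G0 where "G0 = \<lparr>pverts = ?U, parcs = ?E \<inter> ?U \<times> ?U\<rparr>"
  have UG: "?U \<subseteq> pverts G" using B by blast
  have G0: "pair_graph G0"
    unfolding pair_graph_iff G0_def using Gp finite_subset[OF UG] by (auto simp: sym_def irrefl_def)
  define idx where "idx v = (THE i. i \<in> I \<and> v \<in> B i)" for v
  have idx: "idx v = i" if "i \<in> I" "v \<in> B i" for i v
    unfolding idx_def using that dis by (intro the_equality) blast+
  define rep where "rep i = (SOME v. v \<in> B i)" for i
  have rep: "rep i \<in> B i" if "i \<in> I" for i
    unfolding rep_def using B[OF that] conn_nonempty some_in_eq by metis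
  define f where "f v = rep (idx v)" for v
  have f: "f v = rep i" if "i \<in> I" "v \<in> B i" for i v using idx[OF that] by (simp add: f_def)
  have idx_rep: "idx (rep i) = i" if "i \<in> I" for i using idx rep that by blast
  have idx_f: "idx (f v) = idx v" if "v \<in> ?U" for v using that f idx idx_rep by auto
  have contr: "edge_contraction\<^sup>*\<^sup>* G0 (quotient_graph G0 f)"
  proof (rule edge_contraction_quotient[OF G0])
    show "f v \<in> pverts G0 \<and> f (f v) = f v" if "v \<in> pverts G0" for v
      using that f rep by (fastforce simp: G0_def)
    show "conn (parcs G0) {w \<in> pverts G0. f w = f v}" if v: "v \<in> pverts G0" for v
    proof -
      obtain i where i: "i \<in> I" "v \<in> B i" using v by (auto simp: G0_def)
      have "{w \<in> pverts G0. f w = f v} = B i"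
      proof -
        have "w \<in> B i" if w: "w \<in> pverts G0" "f w = f v" for w
        proof -
          obtain j where j: "j \<in> I" "w \<in> B j" using w by (auto simp: G0_def)
          then have "rep i = rep j" using f i w(2) by metis
          then show ?thesis using idx_rep i j by metis
        qed
        moreover have "w \<in> pverts G0 \<and> f w = f v" if "w \<in> B i" for w
          using that i f by (auto simp: G0_def)
        ultimately show ?thesis by blast
      qed
      moreover have "conn (parcs G0) (B i)"
        using B[OF i(1)] conn_cong[of "B i" "parcs G0" ?E] i(1) by (auto simp: G0_def)
      ultimately show ?thesis by simp
    qed
  qed
  let ?Q = "quotient_graph G0 f"
  have Qv: "pverts ?Q = rep ` I"
    unfolding quotient_graph_def G0_def using f rep by (force simp: image_iff)
  have Q: "pair_graph ?Q" by (rule pair_graph_quotient[OF G0])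
  then have Qsub: "parcs ?Q \<subseteq> pverts ?Q \<times> pverts ?Q" unfolding pair_graph_iff by auto
  let ?H = "branch_graph ?E I B"
  have inj: "inj_on idx (pverts ?Q)" unfolding Qv by (rule inj_onI) (use idx_rep in auto)
  have iv: "idx ` pverts ?Q = I" unfolding Qv using idx_rep by (auto simp: image_image)
  have ia: "map_prod idx idx ` parcs ?Q = parcs ?H"
  proof (intro equalityI subsetI)
    fix e assume "e \<in> map_prod idx idx ` parcs ?Q"
    then obtain a b where ab: "(a, b) \<in> parcs G0" "f a \<noteq> f b" "e = (idx (f a), idx (f b))"
      unfolding quotient_graph_def by auto
    then obtain i j where ij: "i \<in> I" "a \<in> B i" "j \<in> I" "b \<in> B j" "(a, b) \<in> ?E"
      by (auto simp: G0_def)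
    moreover have "i \<noteq> j" using ab(2) f ij by auto
    moreover have "e = (i, j)" using ab(3) ij f idx_rep by auto
    ultimately show "e \<in> parcs ?H" by (auto simp: branch_graph_def)
  next
    fix e assume "e \<in> parcs ?H"
    then obtain i j a b where ij: "e = (i, j)" "i \<in> I" "j \<in> I" "i \<noteq> j" "a \<in> B i" "b \<in> B j" "(a, b) \<in> ?E"
      by (auto simp: branch_graph_def)
    have "(a, b) \<in> parcs G0" using ij by (auto simp: G0_def)
    moreover have "f a = rep i" "f b = rep j" using f ij by auto
    moreover have "rep i \<noteq> rep j" using idx_rep ij by metis
    ultimately have "(rep i, rep j) \<in> parcs ?Q" unfolding quotient_graph_def by force
    then show "e \<in> map_prod idx idx ` parcs ?Q"
      using idx_rep ij by (intro image_eqI[of _ _ "(rep i, rep j)"]) auto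
  qed
  have "digraph_iso (with_proj ?Q) (with_proj ?H)"
    unfolding digraph_iso_def
  proof (intro exI conjI)
    let ?h = "\<lparr>iso_verts = idx, iso_arcs = map_prod idx idx, iso_head = snd, iso_tail = fst\<rparr>"
    have "inj_on (map_prod idx idx) (parcs ?Q)"
      using map_prod_inj_on[OF inj inj] Qsub by (rule inj_on_subset)
    moreover have "wf_digraph (with_proj ?Q)"
      using Q by (simp add: wf_digraph_wp_iff pair_graph_def pair_digraph_def pair_fin_digraph_def)
    ultimately show "pre_digraph.digraph_isomorphism (with_proj ?Q) ?h"
      unfolding pre_digraph.digraph_isomorphism_def using inj by auto
    show "with_proj ?H = app_iso ?h (with_proj ?Q)"
      unfolding app_iso_def using iv ia by (simp add: with_proj_def branch_graph_def)
  qed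
  moreover have "subgraph (with_proj G0) (with_proj G)"
    unfolding subgraph_def compatible_def
    using UG G G0 by (auto simp: G0_def wf_digraph_wp_iff pair_graph_def pair_digraph_def pair_fin_digraph_def)
  ultimately show ?thesis unfolding minor_def using G0 contr by blast
qed

text \<open>Greedy growth: while the sets do not exhaust \<open>C\<close>, some edge leaves their
  union, and its outer end joins the set that it leaves. Covering all of \<open>C\<close> is what
  makes the branch sets inside \<open>C\<close> induce a connected graph.\<close>

lemma extend_to_cover:
  assumes "sym E" "conn E C" "finite C" "finite I" "I \<noteq> {}"
    and "\<And>i. i \<in> I \<Longrightarrow> conn E (S i) \<and> S i \<subseteq> C"
    and "\<And>i j. \<lbrakk>i \<in> I; j \<in> I; i \<noteq> j\<rbrakk> \<Longrightarrow> S i \<inter> S j = {}"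
  shows "\<exists>S'. (\<forall>i\<in>I. S i \<subseteq> S' i \<and> conn E (S' i)) \<and> (\<forall>i\<in>I. \<forall>j\<in>I. i \<noteq> j \<longrightarrow> S' i \<inter> S' j = {}) \<and>
    (\<Union>i\<in>I. S' i) = C"
  using assms(6,7)
proof (induction "card (C - (\<Union>i\<in>I. S i))" arbitrary: S rule: less_induct)
  case less
  let ?U = "\<Union>i\<in>I. S i"
  have U: "?U \<subseteq> C" using less.prems by blast
  show ?case
  proof (cases "?U = C")
    case True
    then show ?thesis using less.prems by (intro exI[of _ S]) blast
  next
    case False
    have "?U \<noteq> {}" using assms(5) less.prems(1) conn_nonempty by fast
    then obtain a b where ab: "a \<in> ?U" "b \<in> C - ?U" "(a, b) \<in> E"
      using conn_edge_out[OF assms(2), of ?U] U False by blast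
    then obtain i where i: "i \<in> I" "a \<in> S i" by blast
    let ?S = "S(i := insert b (S i))"
    have U': "(\<Union>j\<in>I. ?S j) = insert b ?U" using i by (auto split: if_splits)
    have "card (C - (\<Union>j\<in>I. ?S j)) < card (C - ?U)"
      unfolding U' by (rule psubset_card_mono) (use assms(3) ab in auto)
    moreover have "conn E (?S j) \<and> ?S j \<subseteq> C" if "j \<in> I" for j
      using less.prems(1)[OF that] conn_insert[OF assms(1) _ i(2) ab(3)] ab(2) by auto
    moreover have "?S j \<inter> ?S k = {}" if "j \<in> I" "k \<in> I" "j \<noteq> k" for j k
      using less.prems(2)[OF that] ab(2) that by auto
    ultimately obtain S' where S': "\<forall>i\<in>I. ?S i \<subseteq> S' i \<and> conn E (S' i)"
        "\<forall>i\<in>I. \<forall>j\<in>I. i \<noteq> j \<longrightarrow> S' i \<inter> S' j = {}" "(\<Union>i\<in>I. S' i) = C"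
      using less.hyps[of ?S] by blast
    have "S j \<subseteq> S' j" if "j \<in> I" for j using bspec[OF S'(1) that] by (cases "j = i") auto
    then show ?thesis using S' by blast
  qed
qed

text \<open>The sets \<open>R P\<close> are the branch sets of the clique. The members of
  \<open>SS\<close>, grown to cover \<open>C\<close>, are those of the other side; growing them
  preserves their adjacency to each \<open>R P\<close>.\<close>

lemma J_minor_free_no_model:
  fixes R :: "'c \<Rightarrow> 'a set"
  assumes G: "pair_graph G" and free: "J_minor_free s t G" and t: "0 < t"
    and N: "finite N" "card N = s"
    and R: "\<And>P. P \<in> N \<Longrightarrow> conn (parcs G) (R P) \<and> R P \<subseteq> pverts G"
    and RR: "\<And>P Q. \<lbrakk>P \<in> N; Q \<in> N; P \<noteq> Q\<rbrakk> \<Longrightarrow> R P \<inter> R Q = {} \<and> (\<exists>a\<in>R P. \<exists>b\<in>R Q. (a, b) \<in> parcs G)"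
    and C: "conn (parcs G) C" "C \<subseteq> pverts G" "\<And>P. P \<in> N \<Longrightarrow> R P \<inter> C = {}"
    and SS: "card SS = t"
      "\<And>S. S \<in> SS \<Longrightarrow> conn (parcs G) S \<and> S \<subseteq> C \<and> (\<forall>P\<in>N. \<exists>a\<in>S. \<exists>b\<in>R P. (a, b) \<in> parcs G)"
      "\<And>S S'. \<lbrakk>S \<in> SS; S' \<in> SS; S \<noteq> S'\<rbrakk> \<Longrightarrow> S \<inter> S' = {}"
  shows False
proof -
  let ?E = "parcs G"
  have Gp: "finite (pverts G)" "sym ?E" using G unfolding pair_graph_iff by auto
  obtain p where p: "bij_betw p {0..<s} N" using ex_bij_betw_nat_finite[OF N(1)] N(2) by auto
  have finS: "finite SS" using SS(1) t card_gt_0_iff by metis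
  obtain q where q: "bij_betw q SS {s..<s + t}"
    using finite_same_card_bij[OF finS, of "{s..<s + t}"] SS(1) by auto
  define S where "S = inv_into SS q"
  have S: "bij_betw S {s..<s + t} SS" unfolding S_def by (rule bij_betw_inv_into[OF q])
  have SI: "S i \<in> SS" if "i \<in> {s..<s + t}" for i using S that bij_betwE by blast
  have SJ: "S i \<inter> S j = {}" if "i \<in> {s..<s + t}" "j \<in> {s..<s + t}" "i \<noteq> j" for i j
    using SS(3)[OF SI SI] S that by (metis bij_betw_def inj_on_def)
  have "\<exists>S'. (\<forall>i\<in>{s..<s + t}. S i \<subseteq> S' i \<and> conn ?E (S' i)) \<and>
      (\<forall>i\<in>{s..<s + t}. \<forall>j\<in>{s..<s + t}. i \<noteq> j \<longrightarrow> S' i \<inter> S' j = {}) \<and> (\<Union>i\<in>{s..<s + t}. S' i) = C"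
    by (rule extend_to_cover[OF Gp(2) C(1)])
      (use C(2) Gp(1) t SI SS(2) SJ in \<open>auto intro: finite_subset\<close>)
  then obtain S' where S': "\<And>i. i \<in> {s..<s + t} \<Longrightarrow> S i \<subseteq> S' i \<and> conn ?E (S' i)"
      "\<And>i j. \<lbrakk>i \<in> {s..<s + t}; j \<in> {s..<s + t}; i \<noteq> j\<rbrakk> \<Longrightarrow> S' i \<inter> S' j = {}"
      "(\<Union>i\<in>{s..<s + t}. S' i) = C"
    by blast
  \<comment> \<open>Indices below \<open>s\<close> carry the clique, the next \<open>t\<close> the
    connected side. They are natural numbers because \<open>J_minor_free\<close> speaks of graphs on
    \<open>nat\<close>.\<close>
  define B where "B i = (if i < s then R (p i) else S' i)" for i
  have pN: "p i \<in> N" if "i < s" for i using p that bij_betwE by fastforce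
  have pne: "p i \<noteq> p j" if "i < s" "j < s" "i \<noteq> j" for i j
    using p that unfolding bij_betw_def inj_on_def by auto
  let ?I = "{0..<s + t}"
  let ?H = "branch_graph ?E ?I B"
  have SC: "S' i \<subseteq> C" if "s \<le> i" "i < s + t" for i using S'(3) that by auto
  have "minor ?H G"
  proof (rule minor_branch_graph[OF G])
    show "B i \<subseteq> pverts G \<and> conn ?E (B i)" if "i \<in> ?I" for i
      using that R[OF pN[of i]] S'(1)[of i] subset_trans[OF SC[of i] C(2)] by (auto simp: B_def)
    show "B i \<inter> B j = {}" if "i \<in> ?I" "j \<in> ?I" "i \<noteq> j" for i j
    proof -
      have 1: "B i \<inter> B j = {}" if "i < s" "j < s" "i \<noteq> j" for i j
        using that RR[OF pN pN pne] by (auto simp: B_def)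
      have 2: "B i \<inter> B j = {}" if "i < s" "s \<le> j" "j < s + t" for i j
        using that C(3)[OF pN[of i]] SC[of j] by (auto simp: B_def)
      have 3: "B i \<inter> B j = {}" if "s \<le> i" "i < s + t" "s \<le> j" "j < s + t" "i \<noteq> j" for i j
        using that S'(2)[of i j] by (auto simp: B_def)
      show ?thesis using 1[of i j] 2[of i j] 2[of j i] 3[of i j] that by (cases "i < s"; cases "j < s") auto
    qed
  qed simp
  moreover have "?H \<in> J_class s t"
  proof -
    have pg: "pair_graph ?H" by (rule pair_graph_branch_graph) (use Gp in auto)
    have clique: "(u, v) \<in> parcs ?H" if "u < s" "v < s" "u \<noteq> v" for u v
      using that RR[OF pN pN pne] by (auto simp: branch_graph_def B_def)
    have join: "(a, b) \<in> parcs ?H" if ab: "a < s" "s \<le> b" "b < s + t" for a b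
    proof -
      obtain x y where "x \<in> S b" "y \<in> R (p a)" "(x, y) \<in> ?E"
        using SS(2)[OF SI[of b]] pN[OF ab(1)] ab by auto
      moreover from this have "x \<in> S' b" using S'(1)[of b] ab by auto
      ultimately have "\<exists>y\<in>B a. \<exists>x\<in>B b. (y, x) \<in> ?E" using Gp(2) ab by (auto simp: B_def dest: symD)
      then show ?thesis using ab by (auto simp: branch_graph_def)
    qed
    have "conn (parcs ?H) {s..<s + t}"
    proof -
      \<comment> \<open>Each vertex of \<open>C\<close> goes to the index of its branch set. The
        image of the connected set \<open>C\<close> is the whole index range, which is therefore
        connected in the minor.\<close>
      define h where "h v = (THE i. i \<in> {s..<s + t} \<and> v \<in> S' i)" for v
      have h: "h v = i" if "i \<in> {s..<s + t}" "v \<in> S' i" for i v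
        unfolding h_def using that S'(2) by (intro the_equality) blast+
      have hC: "h v \<in> {s..<s + t} \<and> v \<in> S' (h v)" if "v \<in> C" for v
        using that S'(3) h by blast
      have "conn (parcs ?H) (h ` C)"
      proof (rule conn_image[OF C(1)])
        fix x y assume "x \<in> C" "y \<in> C" "(x, y) \<in> ?E" "h x \<noteq> h y"
        with hC[of x] hC[of y] show "(h x, h y) \<in> parcs ?H" by (auto simp: branch_graph_def B_def)
      qed
      moreover have "h ` C = {s..<s + t}"
      proof (intro equalityI subsetI)
        fix i assume i: "i \<in> {s..<s + t}"
        obtain v where "v \<in> S' i" using S'(1)[OF i] conn_nonempty by blast
        with i h S'(3) show "i \<in> h ` C" by blast
      qed (use hC in blast)
      ultimately show ?thesis by simp
    qed
    then have "connected (with_proj ?H \<restriction> {s..<s + t})"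
      using conn_induce_subgraph_iff[OF pg, of "{s..<s + t}"] by (simp add: branch_graph_def)
    moreover have "{0..<s} \<union> {s..<s + t} = pverts ?H" by (auto simp: branch_graph_def)
    ultimately show ?thesis
      unfolding J_class_def using pg clique join
      by (intro CollectI conjI exI[of _ "{0..<s}"] exI[of _ "{s..<s + t}"]) auto
  qed
  ultimately show False using free unfolding J_minor_free_def by blast
qed

section \<open>Hitting connected sets with few bags\<close>

text \<open>The decomposition in terms of sets of pairs, with an arbitrary node \<open>r\<close>
  fixed as root so that one can speak of lowest nodes.\<close>

locale tree_decomp =
  fixes V :: "'a set" and E :: "('a \<times> 'a) set"
    and X :: "'b set" and F :: "('b \<times> 'b) set" and W :: "'b \<Rightarrow> 'a set" and r :: 'b
  assumes sym_E: "sym E"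
    and finite_X: "finite X" and sym_F: "sym F" and conn_X: "conn F X"
    and single_attach_F: "single_attach F" and root: "r \<in> X"
    and conn_bags: "\<And>v. v \<in> V \<Longrightarrow> conn F {x \<in> X. v \<in> W x}"
    and edge_bag: "\<And>u v. (u, v) \<in> E \<Longrightarrow> \<exists>x\<in>X. u \<in> W x \<and> v \<in> W x"
begin

text \<open>\<open>below z\<close> is the subtree hanging off \<open>z\<close> when the tree is rooted at \<open>r\<close>.\<close>

definition below :: "'b \<Rightarrow> 'b set" where
  "below z = {y \<in> X. \<not> (\<exists>P. conn F P \<and> P \<subseteq> X - {z} \<and> r \<in> P \<and> y \<in> P)}"

definition bags_below :: "'b \<Rightarrow> 'a set" where
  "bags_below z = (\<Union>x\<in>below z. W x)"

lemma below_root: "below r = X"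
  unfolding below_def by blast

lemma below_self: "z \<in> X \<Longrightarrow> z \<in> below z"
  unfolding below_def by blast

text \<open>A node of \<open>P\<close> outside \<open>below z\<close> is joined to \<open>r\<close>
  by a connected set avoiding \<open>z\<close>. Its union with \<open>P\<close> would join all of
  \<open>P\<close> to \<open>r\<close> in the same way.\<close>

lemma below_side:
  assumes "conn F P" "P \<subseteq> X - {z}" "P \<inter> below z \<noteq> {}"
  shows "P \<subseteq> below z"
proof (rule ccontr)
  assume "\<not> P \<subseteq> below z"
  then obtain p where p: "p \<in> P" "p \<notin> below z" by blast
  then obtain Q where Q: "conn F Q" "Q \<subseteq> X - {z}" "r \<in> Q" "p \<in> Q"
    using assms(2) unfolding below_def by blast
  have "conn F (P \<union> Q)" by (rule conn_Un[OF sym_F assms(1) Q(1) p(1) Q(4)]) simp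
  moreover have "P \<union> Q \<subseteq> X - {z}" using assms(2) Q(2) by blast
  ultimately have "y \<notin> below z" if "y \<in> P" for y
    unfolding below_def using that Q(3) by blast
  then show False using assms(3) by blast
qed

text \<open>The node \<open>y\<close> is the child of \<open>z\<close> in the component
  \<open>Q\<close> of the tree minus \<open>z\<close> that contains \<open>P\<close>, that is, the
  unique neighbour of \<open>z\<close> in \<open>Q\<close>.\<close>

lemma below_child:
  assumes z: "z \<in> X" and P: "conn F P" "P \<subseteq> below z - {z}"
  shows "\<exists>y\<in>X. P \<subseteq> below y \<and> below y \<subset> below z"
proof -
  have PX: "P \<subseteq> X - {z}" using P(2) unfolding below_def by blast
  obtain p where p: "p \<in> P" using conn_nonempty[OF P(1)] by blast
  obtain Q where Q: "component_of F (X - {z}) Q" "p \<in> Q"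
    using component_of_exists[OF sym_F, of p "X - {z}"] p PX by blast
  note Qd = component_ofD[OF Q(1)]
  have PQ: "P \<subseteq> Q" using conn_subset_component[OF Q(1) P(1) PX] p Q(2) by blast
  have Qb: "Q \<subseteq> below z" using below_side[OF Qd(2,1)] Q(2) p P(2) by blast
  have out: "b = z" if "a \<in> Q" "b \<in> X - Q" "(a, b) \<in> F" for a b
    using Qd(3)[of a b] that by blast
  have rQ: "r \<notin> Q"
  proof (cases "z = r")
    case False
    then have "r \<notin> below z" unfolding below_def using conn_singleton[of F r] root by blast
    then show ?thesis using Qb by blast
  qed (use Qd(1) in blast)
  have "Q \<subset> X" using Qd(1) z by blast
  then obtain y b where yb: "y \<in> Q" "b \<in> X - Q" "(y, b) \<in> F"
    by (rule conn_edge_out[OF conn_X]) (use Q(2) in blast)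
  then have yz: "(y, z) \<in> F" using out by blast
  have "Q \<subseteq> below y"
  proof
    fix q assume q: "q \<in> Q"
    \<comment> \<open>A connection from \<open>r\<close> to \<open>q\<close> can enter
      \<open>Q\<close> only from \<open>z\<close>, and by \<open>single_attach\<close> only at
      \<open>y\<close>.\<close>
    have False if R: "conn F R" "R \<subseteq> X - {y}" "r \<in> R" "q \<in> R" for R
    proof -
      have "R \<inter> Q \<subset> R" using R(3) rQ by blast
      then obtain a c where ac: "a \<in> R \<inter> Q" "c \<in> R - R \<inter> Q" "(a, c) \<in> F"
        by (rule conn_edge_out[OF R(1)]) (use q R(4) in blast)
      then have "c = z" using out[of a c] R(2) by blast
      then have "(z, a) \<in> F" "(z, y) \<in> F" using ac(3) yz sym_F by (auto dest: symD)
      moreover have "z \<notin> Q" using Qd(1) by blast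
      ultimately have "a = y" using single_attach_F Qd(2) yb(1) ac(1) unfolding single_attach_def by blast
      then show False using ac(1) R(2) by blast
    qed
    then show "q \<in> below y" unfolding below_def using q Qd(1) by blast
  qed
  moreover have "below y \<subseteq> below z"
  proof
    fix w assume w: "w \<in> below y"
    show "w \<in> below z"
    proof (rule ccontr)
      assume "w \<notin> below z"
      then obtain R where R: "conn F R" "R \<subseteq> X - {z}" "r \<in> R" "w \<in> R"
        using w unfolding below_def by blast
      have "y \<notin> R" using R yb(1) Qb unfolding below_def by blast
      then show False using w R unfolding below_def by blast
    qed
  qed
  moreover have "z \<notin> below y"
  proof -
    \<comment> \<open>The rest of the tree joins \<open>r\<close> to \<open>z\<close> without
      \<open>y\<close>. It is connected: a closed subset missing \<open>z\<close> would be closed in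
      the whole tree, and one containing \<open>z\<close> becomes so after adding
      \<open>Q\<close>.\<close>
    have "conn F (X - Q)"
    proof (rule connI)
      show "X - Q \<noteq> {}" using z Qd(1) by blast
      fix A assume A: "A \<subseteq> X - Q" "A \<noteq> {}" and cl: "\<And>a b. \<lbrakk>a \<in> A; b \<in> X - Q; (a, b) \<in> F\<rbrakk> \<Longrightarrow> b \<in> A"
      have zA: "z \<in> A"
      proof (rule ccontr)
        assume "z \<notin> A"
        have "X \<subseteq> A"
        proof (rule connD[OF conn_X])
          show "A \<inter> X \<noteq> {}" using A by blast
          fix a b assume ab: "a \<in> A" "a \<in> X" "b \<in> X" "(a, b) \<in> F"
          have "b \<notin> Q"
          proof
            assume "b \<in> Q"
            then have "a = z" using out[of b a] ab A(1) sym_F by (auto dest: symD)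
            then show False using ab \<open>z \<notin> A\<close> by blast
          qed
          then show "b \<in> A" using cl ab by blast
        qed
        then show False using z \<open>z \<notin> A\<close> by blast
      qed
      have "X \<subseteq> A \<union> Q"
      proof (rule connD[OF conn_X])
        show "(A \<union> Q) \<inter> X \<noteq> {}" using A by blast
        fix a b assume ab: "a \<in> A \<union> Q" "a \<in> X" "b \<in> X" "(a, b) \<in> F"
        show "b \<in> A \<union> Q" using cl[of a b] out[of a b] ab zA by blast
      qed
      then show "X - Q \<subseteq> A" by blast
    qed
    moreover have "X - Q \<subseteq> X - {y}" "r \<in> X - Q" "z \<in> X - Q" using yb(1) rQ root z Qd(1) by blast+
    ultimately show ?thesis unfolding below_def by blast
  qed
  ultimately have "P \<subseteq> below y \<and> below y \<subset> below z" using PQ below_self[OF z] by blast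
  then show ?thesis using yb(1) Qd(1) by blast
qed

text \<open>The nodes of each single vertex of \<open>S\<close> form a connected set, and the ends
  of an edge share a bag. A closed set of nodes thus takes over the subtree of one vertex after
  another along the edges of \<open>S\<close>.\<close>

lemma conn_trace:
  assumes "conn E S" "S \<subseteq> V"
  shows "conn F {x \<in> X. W x \<inter> S \<noteq> {}}" (is "conn F ?T")
proof (rule connI)
  obtain v where v: "v \<in> S" using conn_nonempty[OF assms(1)] by blast
  then show "?T \<noteq> {}" using conn_nonempty[OF conn_bags[of v]] assms(2) by blast
  fix A assume A: "A \<subseteq> ?T" "A \<noteq> {}" and cl: "\<And>a b. \<lbrakk>a \<in> A; b \<in> ?T; (a, b) \<in> F\<rbrakk> \<Longrightarrow> b \<in> A"
  have tr: "{x \<in> X. v \<in> W x} \<subseteq> A" if "v \<in> S" "x \<in> A" "v \<in> W x" for v x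
  proof (rule connD[OF conn_bags])
    show "v \<in> V" using that(1) assms(2) by blast
    show "A \<inter> {x \<in> X. v \<in> W x} \<noteq> {}" using that A(1) by blast
    fix a b assume "a \<in> A" "a \<in> {x \<in> X. v \<in> W x}" "b \<in> {x \<in> X. v \<in> W x}" "(a, b) \<in> F"
    then show "b \<in> A" using cl[of a b] that(1) by blast
  qed
  have "S \<subseteq> {v. {x \<in> X. v \<in> W x} \<subseteq> A}"
  proof (rule connD[OF assms(1)])
    obtain x where "x \<in> A" using A(2) by blast
    moreover from this obtain v where "v \<in> S" "v \<in> W x" using A(1) by blast
    ultimately have "{x \<in> X. v \<in> W x} \<subseteq> A" by (intro tr)
    then show "{v. {x \<in> X. v \<in> W x} \<subseteq> A} \<inter> S \<noteq> {}" using \<open>v \<in> S\<close> by blast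
    fix a b assume ab: "a \<in> {v. {x \<in> X. v \<in> W x} \<subseteq> A}" "b \<in> S" "(a, b) \<in> E"
    obtain y where "y \<in> X" "a \<in> W y" "b \<in> W y" using edge_bag[OF ab(3)] by blast
    then have "y \<in> A" "b \<in> W y" using ab(1) by blast+
    then show "b \<in> {v. {x \<in> X. v \<in> W x} \<subseteq> A}" using tr ab(2) by blast
  qed
  then show "?T \<subseteq> A" by blast
qed

lemma bags_below_root: "V \<subseteq> bags_below r"
  unfolding bags_below_def below_root using conn_bags conn_nonempty by blast

text \<open>The trace of \<open>S\<close> in the tree is connected and misses \<open>z\<close>, so
  it stays below \<open>z\<close> and hence below one child. This is what contradicts the choice of
  a lowest node later on.\<close>

lemma avoiding_bag_descends:
  assumes z: "z \<in> X" and S: "conn E S" "S \<subseteq> V" "S \<inter> W z = {}" "S \<inter> bags_below z \<noteq> {}"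
  shows "\<exists>y\<in>X. S \<subseteq> bags_below y \<and> below y \<subset> below z"
proof -
  let ?T = "{x \<in> X. W x \<inter> S \<noteq> {}}"
  have T: "conn F ?T" by (rule conn_trace[OF S(1,2)])
  have Tz: "?T \<subseteq> X - {z}" using S(3) by blast
  have "?T \<inter> below z \<noteq> {}" using S(4) unfolding bags_below_def below_def by blast
  then have "?T \<subseteq> below z" by (rule below_side[OF T Tz])
  then obtain y where y: "y \<in> X" "?T \<subseteq> below y" "below y \<subset> below z"
    using below_child[OF z T] Tz by blast
  have "S \<subseteq> bags_below y"
  proof
    fix v assume v: "v \<in> S"
    then obtain x where "x \<in> X" "v \<in> W x" using conn_nonempty[OF conn_bags[of v]] S(2) by blast
    then show "v \<in> bags_below y" unfolding bags_below_def using y(2) v by blast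
  qed
  then show ?thesis using y by blast
qed

text \<open>Height is measured by the size of \<open>below z\<close>. The root qualifies because its
  subtree is the whole tree, so a minimum exists.\<close>

lemma lowest_node:
  assumes "S \<in> \<F>" "S \<subseteq> V"
  obtains z S' where "z \<in> X" "S' \<in> \<F>" "S' \<subseteq> bags_below z"
    "\<forall>y\<in>X. below y \<subset> below z \<longrightarrow> (\<forall>S''\<in>\<F>. \<not> S'' \<subseteq> bags_below y)"
proof -
  let ?P = "\<lambda>z. z \<in> X \<and> (\<exists>S\<in>\<F>. S \<subseteq> bags_below z)"
  have "?P r" using root bags_below_root assms by blast
  then obtain z where z: "?P z" "\<And>y. ?P y \<Longrightarrow> card (below z) \<le> card (below y)"
    using ex_has_least_nat[of ?P r "\<lambda>z. card (below z)"] by blast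
  have fin: "finite (below z)" using finite_X unfolding below_def by simp
  have "\<not> S'' \<subseteq> bags_below y" if "y \<in> X" "below y \<subset> below z" "S'' \<in> \<F>" for y S''
    using z(2)[of y] psubset_card_mono[OF fin that(2)] that by force
  then show thesis using that[of z] z(1) by blast
qed

text \<open>The Erdos-Posa property of subtrees of a tree, transported to connected sets.\<close>

lemma packing_or_hitting:
  assumes "\<And>S. S \<in> \<F> \<Longrightarrow> conn E S \<and> S \<subseteq> V"
  shows "(\<exists>\<S>\<subseteq>\<F>. finite \<S> \<and> card \<S> = n \<and> (\<forall>S\<in>\<S>. \<forall>S'\<in>\<S>. S \<noteq> S' \<longrightarrow> S \<inter> S' = {})) \<or>
    (\<exists>N\<subseteq>X. card N < n \<and> (\<forall>S\<in>\<F>. S \<inter> (\<Union>x\<in>N. W x) \<noteq> {}))"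
  using assms
proof (induction n arbitrary: \<F>)
  case 0
  show ?case by (intro disjI1 exI[of _ "{}"]) simp
next
  case (Suc n)
  show ?case
  proof (cases "\<F> = {}")
    case True
    then show ?thesis by (intro disjI2 exI[of _ "{}"]) simp
  next
    case False
    then obtain S0 where S0: "S0 \<in> \<F>" "S0 \<subseteq> V" using Suc.prems by blast
    obtain z S where zS: "z \<in> X" "S \<in> \<F>" "S \<subseteq> bags_below z"
      and low: "\<forall>y\<in>X. below y \<subset> below z \<longrightarrow> (\<forall>S''\<in>\<F>. \<not> S'' \<subseteq> bags_below y)"
      by (rule lowest_node[OF S0])
    let ?G = "{S' \<in> \<F>. S' \<inter> W z = {}}"
    \<comment> \<open>A member that meets \<open>S\<close> but avoids the bag at \<open>z\<close>
      would lie below a child of \<open>z\<close>, although \<open>z\<close> is lowest. So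
      \<open>S\<close> can be added to any packing in \<open>?G\<close>, and \<open>z\<close> to any
      hitting set for it.\<close>
    have dis: "S' \<inter> S = {}" if "S' \<in> ?G" for S'
    proof (rule ccontr)
      assume "S' \<inter> S \<noteq> {}"
      then have "S' \<inter> bags_below z \<noteq> {}" using zS(3) by blast
      then show False
        using avoiding_bag_descends[OF zS(1), of S'] Suc.prems[of S'] that low by blast
    qed
    from Suc.IH[of ?G] Suc.prems consider
      (pack) \<S> where "\<S> \<subseteq> ?G" "finite \<S>" "card \<S> = n" "\<forall>S\<in>\<S>. \<forall>S'\<in>\<S>. S \<noteq> S' \<longrightarrow> S \<inter> S' = {}"
      | (hit) N where "N \<subseteq> X" "card N < n" "\<forall>S\<in>?G. S \<inter> (\<Union>x\<in>N. W x) \<noteq> {}"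
      by (simp only: mem_Collect_eq) blast
    then show ?thesis
    proof cases
      case pack
      have "S \<noteq> {}" using Suc.prems[OF zS(2)] conn_nonempty by blast
      then have "S \<notin> \<S>" using dis pack(1) by blast
      then have "card (insert S \<S>) = Suc n" using pack by simp
      moreover have "\<forall>S1\<in>insert S \<S>. \<forall>S2\<in>insert S \<S>. S1 \<noteq> S2 \<longrightarrow> S1 \<inter> S2 = {}"
        using pack(1,4) dis by blast
      moreover have "insert S \<S> \<subseteq> \<F>" using pack(1) zS(2) by blast
      ultimately show ?thesis using pack(2) by (intro disjI1 exI[of _ "insert S \<S>"]) simp
    next
      case hit
      have "card (insert z N) < Suc n"
        using hit(1,2) finite_subset[OF hit(1) finite_X] by (simp add: card_insert_if)
      moreover have "\<forall>S\<in>\<F>. S \<inter> (\<Union>x\<in>insert z N. W x) \<noteq> {}"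
        using hit(3) by blast
      ultimately show ?thesis using hit(1) zS(1) by (intro disjI2 exI[of _ "insert z N"]) simp
    qed
  qed
qed

text \<open>Take \<open>z\<close> lowest such that some connected subset of \<open>C\<close> with
  property \<open>Q\<close> lies below it, grow that subset to a component \<open>K\<close> of the
  part of \<open>C\<close> below \<open>z\<close>, and remove \<open>W z\<close> from
  \<open>K\<close>. A leftover component with \<open>Q\<close> that met \<open>K\<close> would
  descend to a child of \<open>z\<close>; so it is disjoint from \<open>K\<close>, and its
  neighbours in \<open>C\<close> are removed vertices, all in \<open>K\<close>.\<close>

lemma single_bag_split:
  assumes C: "conn E C" "C \<subseteq> V" "Q C" and mono: "\<And>S S'. \<lbrakk>Q S; S \<subseteq> S'\<rbrakk> \<Longrightarrow> Q S'"
  obtains z Y where "z \<in> X" "Y \<subseteq> C" "Y \<subseteq> W z"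
    "\<forall>D. component_of E (C - Y) D \<longrightarrow> Q D \<longrightarrow>
       (\<exists>K. conn E K \<and> Q K \<and> K \<subseteq> C - D \<and> (\<forall>a\<in>D. \<forall>b\<in>C - D. (a, b) \<in> E \<longrightarrow> b \<in> K))"
proof -
  let ?F = "{S. conn E S \<and> S \<subseteq> C \<and> Q S}"
  have CF: "C \<in> ?F" using C by blast
  obtain z S where zS: "z \<in> X" "S \<in> ?F" "S \<subseteq> bags_below z"
    and low: "\<forall>y\<in>X. below y \<subset> below z \<longrightarrow> (\<forall>S''\<in>?F. \<not> S'' \<subseteq> bags_below y)"
    by (rule lowest_node[OF CF C(2)])
  have S: "conn E S" "S \<subseteq> C" "Q S" using zS(2) by blast+
  obtain v where v: "v \<in> S" using conn_nonempty[OF S(1)] by blast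
  let ?U = "C \<inter> bags_below z"
  obtain K where K: "component_of E ?U K" "v \<in> K"
    using component_of_exists[OF sym_E, of v ?U] v S(2) zS(3) by blast
  note Kd = component_ofD[OF K(1)]
  have "S \<subseteq> K" using conn_subset_component[OF K(1) S(1)] S(2) zS(3) v K(2) by blast
  with S(3) have QK: "Q K" by (rule mono)
  show thesis
  proof (rule that[OF zS(1), of "W z \<inter> K"])
    show "W z \<inter> K \<subseteq> C" "W z \<inter> K \<subseteq> W z" using Kd(1) by blast+
    show "\<forall>D. component_of E (C - W z \<inter> K) D \<longrightarrow> Q D \<longrightarrow>
       (\<exists>K. conn E K \<and> Q K \<and> K \<subseteq> C - D \<and> (\<forall>a\<in>D. \<forall>b\<in>C - D. (a, b) \<in> E \<longrightarrow> b \<in> K))"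
    proof (intro allI impI)
      fix D assume D: "component_of E (C - W z \<inter> K) D" and QD: "Q D"
      note Dd = component_ofD[OF D]
      have "D \<inter> K = {}"
      proof (rule ccontr)
        assume DK: "D \<inter> K \<noteq> {}"
        \<comment> \<open>A vertex of \<open>K\<close> off \<open>W z\<close> has all its bags
          strictly below \<open>z\<close>, so its neighbours occur below \<open>z\<close> too, and
          those in \<open>C\<close> belong to \<open>K\<close>.\<close>
        have DsK: "D \<subseteq> K"
        proof (rule connD[OF Dd(2)])
          show "K \<inter> D \<noteq> {}" using DK by blast
          fix a b assume ab: "a \<in> K" "a \<in> D" "b \<in> D" "(a, b) \<in> E"
          have az: "a \<notin> W z" "a \<in> V" using ab(1,2) Dd(1) C(2) by blast+
          let ?B = "{x \<in> X. a \<in> W x}"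
          have "?B \<inter> below z \<noteq> {}"
            using ab(1) Kd(1) unfolding bags_below_def below_def by blast
          then have "?B \<subseteq> below z" by (intro below_side[OF conn_bags[OF az(2)]]) (use az(1) in blast)
          then have "b \<in> bags_below z" using edge_bag[OF ab(4)] unfolding bags_below_def by blast
          then show "b \<in> K" using Kd(3)[OF ab(1) _ ab(4)] ab(3) Dd(1) by blast
        qed
        have "D \<inter> W z = {}" "D \<inter> bags_below z \<noteq> {}" "D \<subseteq> V" "D \<subseteq> C"
          using DsK Dd(1) DK Kd(1) C(2) by blast+
        with avoiding_bag_descends[OF zS(1) Dd(2)] obtain y where
          "y \<in> X" "D \<subseteq> bags_below y" "below y \<subset> below z" by blast
        then show False using low \<open>y \<in> X\<close> Dd(2) QD \<open>D \<subseteq> C\<close> by blast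
      qed
      moreover have "b \<in> K" if "a \<in> D" "b \<in> C - D" "(a, b) \<in> E" for a b
        using Dd(3)[of a b] that by blast
      ultimately show "\<exists>K. conn E K \<and> Q K \<and> K \<subseteq> C - D \<and> (\<forall>a\<in>D. \<forall>b\<in>C - D. (a, b) \<in> E \<longrightarrow> b \<in> K)"
        using Kd(1,2) QK by (intro exI[of _ K]) blast
    qed
  qed
qed

end

section \<open>Choosing a new part\<close>

definition touches :: "('a \<times> 'a) set \<Rightarrow> 'a set \<Rightarrow> 'a set \<Rightarrow> bool" where
  "touches E A B \<longleftrightarrow> (\<exists>a\<in>A. \<exists>b\<in>B. (a, b) \<in> E)"

lemma touches_sym: "sym E \<Longrightarrow> touches E A B \<Longrightarrow> touches E B A"
  unfolding touches_def by (auto dest: symD)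

lemma touches_mono: "touches E A B \<Longrightarrow> A \<subseteq> A' \<Longrightarrow> B \<subseteq> B' \<Longrightarrow> touches E A' B'"
  unfolding touches_def by blast

text \<open>Discarding from \<open>Y\<close> a component of \<open>C - D\<close> that sees only colours of \<open>D\<close> keeps the property.\<close>

lemma minimal_split:
  assumes E: "sym E" and C: "conn E C" "finite C" "\<forall>P\<in>N. touches E C P"
    and Y0: "Y0 \<subseteq> C" "\<forall>D. component_of E (C - Y0) D \<longrightarrow> (\<forall>P\<in>N. touches E D P) \<longrightarrow> good D"
    and "\<not> good C"
  obtains Y where "Y \<subseteq> Y0" "Y \<noteq> {}"
    "\<forall>D. component_of E (C - Y) D \<longrightarrow> (\<forall>P\<in>N. touches E D P) \<longrightarrow> good D"
    "\<forall>D Z. component_of E (C - Y) D \<longrightarrow> \<not> (\<forall>P\<in>N. touches E D P) \<longrightarrow> component_of E (C - D) Z \<longrightarrow>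
       (\<exists>P\<in>N. \<not> touches E D P \<and> touches E Z P)"
proof -
  let ?col = "\<lambda>D. \<forall>P\<in>N. touches E D P"
  let ?adm = "\<lambda>Y. Y \<subseteq> Y0 \<and> (\<forall>D. component_of E (C - Y) D \<longrightarrow> ?col D \<longrightarrow> good D)"
  have "?adm Y0" using Y0(2) by simp
  then obtain Y where Y: "?adm Y" and least: "\<And>Y'. ?adm Y' \<Longrightarrow> card Y \<le> card Y'"
    using ex_has_least_nat[of ?adm Y0 card] by blast
  have YC: "Y \<subseteq> C" using Y Y0(1) by blast
  have finY: "finite Y" using YC C(2) by (rule finite_subset)
  have "Y \<noteq> {}"
  proof
    \<comment> \<open>If nothing were removed, \<open>C\<close> itself would be a colourful
      component, hence good, which is excluded.\<close>
    assume "Y = {}"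
    then have "component_of E (C - Y) C" using C(1) by (simp add: component_of_def)
    then have "good C" using Y C(3) by blast
    then show False using assms(7) by blast
  qed
  moreover have "\<exists>P\<in>N. \<not> touches E D P \<and> touches E Z P"
    if D: "component_of E (C - Y) D" and nc: "\<not> ?col D" and Z: "component_of E (C - D) Z" for D Z
  proof (rule ccontr)
    assume "\<not> (\<exists>P\<in>N. \<not> touches E D P \<and> touches E Z P)"
    then have ZD: "touches E D P" if "P \<in> N" "touches E Z P" for P using that by blast
    note Dd = component_ofD[OF D] and Zd = component_ofD[OF Z]
    obtain d where d: "d \<in> D" using conn_nonempty[OF Dd(2)] by blast
    have "Z \<subset> C" using Zd(1) Dd(1) d by blast
    then obtain a b where ab: "a \<in> Z" "b \<in> C - Z" "(a, b) \<in> E"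
      by (rule conn_edge_out[OF C(1)]) (use conn_nonempty[OF Zd(2)] in blast)
    have bD: "b \<in> D" using Zd(3)[of a b] ab by blast
    have ba: "(b, a) \<in> E" using ab(3) E by (auto dest: symD)
    \<comment> \<open>The edge from \<open>D\<close> to \<open>a\<close> leaves the component
      \<open>D\<close> of \<open>C - Y\<close>, so \<open>a\<close> is a removed vertex. Hence
      \<open>Y - Z\<close> is strictly smaller than \<open>Y\<close>.\<close>
    have aY: "a \<in> Y" using Dd(3)[OF bD _ ba] ab(1) Zd(1) by blast
    have cDZ: "conn E (D \<union> Z)" using conn_Un[OF E Dd(2) Zd(2) bD ab(1)] ba by blast
    let ?Y = "Y - Z"
    \<comment> \<open>A component after restoring \<open>Y \<inter> Z\<close> either avoids
      \<open>D \<union> Z\<close>, and then it was one before, or lies inside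
      \<open>D \<union> Z\<close>, and then it misses a colour just as \<open>D\<close>
      does.\<close>
    have "good D'" if D': "component_of E (C - ?Y) D'" and col: "?col D'" for D'
    proof (cases "D' \<inter> (D \<union> Z) = {}")
      case True
      note D'd = component_ofD[OF D']
      have "component_of E (C - Y) D'"
        unfolding component_of_def using D'd True by blast
      then show ?thesis using Y col by blast
    next
      case False
      note D'd = component_ofD[OF D']
      have "D' \<subseteq> D \<union> Z"
      proof (rule connD[OF D'd(2)])
        show "(D \<union> Z) \<inter> D' \<noteq> {}" using False by blast
        fix p q assume pq: "p \<in> D \<union> Z" "p \<in> D'" "q \<in> D'" "(p, q) \<in> E"
        have q: "q \<in> C - ?Y" using pq(3) D'd(1) by blast
        show "q \<in> D \<union> Z"
        proof (cases "p \<in> D")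
          case True
          then show ?thesis using Dd(3)[OF True _ pq(4)] q by blast
        next
          case False
          then show ?thesis using Zd(3)[of p q] pq q by blast
        qed
      qed
      then have "touches E D P" if "P \<in> N" for P
        using col ZD that unfolding touches_def by blast
      then show ?thesis using nc by blast
    qed
    then have "?adm ?Y" using Y by blast
    then have "card Y \<le> card ?Y" by (rule least)
    moreover have "card ?Y < card Y" by (rule psubset_card_mono[OF finY]) (use aY ab(1) in blast)
    ultimately show False by simp
  qed
  ultimately show thesis using that[of Y] Y by blast
qed

text \<open>
  The parts \<open>N\<close> around \<open>D\<close> need be neither connected nor pairwise adjacent; the sets \<open>R P\<close> stand in for
  them as branch sets of a clique outside \<open>D\<close>.
\<close>

definition root_model :: "('a \<times> 'a) set \<Rightarrow> 'a set \<Rightarrow> 'a set set \<Rightarrow> 'a set \<Rightarrow> ('a set \<Rightarrow> 'a set) \<Rightarrow> bool" where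
  "root_model E V N D R \<longleftrightarrow>
     (\<forall>P\<in>N. conn E (R P) \<and> R P \<subseteq> V \<and> R P \<inter> D = {} \<and> (\<forall>a\<in>D. \<forall>b\<in>P. (a, b) \<in> E \<longrightarrow> b \<in> R P)) \<and>
     (\<forall>P\<in>N. \<forall>Q\<in>N. P \<noteq> Q \<longrightarrow> R P \<inter> R Q = {} \<and> touches E (R P) (R Q))"

lemma root_modelI:
  assumes "\<And>P. P \<in> N \<Longrightarrow> conn E (R P) \<and> R P \<subseteq> V \<and> R P \<inter> D = {}"
    and "\<And>P a b. \<lbrakk>P \<in> N; a \<in> D; b \<in> P; (a, b) \<in> E\<rbrakk> \<Longrightarrow> b \<in> R P"
    and "\<And>P Q. \<lbrakk>P \<in> N; Q \<in> N; P \<noteq> Q\<rbrakk> \<Longrightarrow> R P \<inter> R Q = {} \<and> touches E (R P) (R Q)"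
  shows "root_model E V N D R"
  using assms unfolding root_model_def by simp

lemma root_modelD:
  assumes "root_model E V N D R" "P \<in> N"
  shows "conn E (R P)" "R P \<subseteq> V" "R P \<inter> D = {}" "\<And>a b. \<lbrakk>a \<in> D; b \<in> P; (a, b) \<in> E\<rbrakk> \<Longrightarrow> b \<in> R P"
    "\<And>Q. \<lbrakk>Q \<in> N; P \<noteq> Q\<rbrakk> \<Longrightarrow> R P \<inter> R Q = {} \<and> touches E (R P) (R Q)"
  using assms unfolding root_model_def by simp_all

lemma root_model_subset:
  assumes R: "root_model E V N D R" and "M \<subseteq> N" "D' \<subseteq> D"
  shows "root_model E V M D' R"
proof (rule root_modelI)
  fix P assume "P \<in> M"
  then have P: "P \<in> N" using assms(2) by blast
  show "conn E (R P) \<and> R P \<subseteq> V \<and> R P \<inter> D' = {}"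
    using root_modelD(1-3)[OF R P] assms(3) by blast
  show "b \<in> R P" if "a \<in> D'" "b \<in> P" "(a, b) \<in> E" for a b
    using root_modelD(4)[OF R P, of a b] that assms(3) by blast
  show "R P \<inter> R Q = {} \<and> touches E (R P) (R Q)" if "Q \<in> M" "P \<noteq> Q" for Q
    using root_modelD(5)[OF R P, of Q] that assms(2) by blast
qed

lemma root_model_insert:
  assumes E: "sym E" and R: "root_model E V N D R" and Y: "Y \<notin> N"
    and K: "conn E K" "K \<subseteq> V" "K \<inter> D = {}" "\<And>a b. \<lbrakk>a \<in> D; b \<in> Y; (a, b) \<in> E\<rbrakk> \<Longrightarrow> b \<in> K"
    and KR: "\<And>P. P \<in> N \<Longrightarrow> K \<inter> R P = {} \<and> touches E K (R P)"
  shows "root_model E V (insert Y N) D (R(Y := K))"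
proof -
  have KR': "R P \<inter> K = {} \<and> touches E (R P) K" if "P \<in> N" for P
    using KR[OF that] touches_sym[OF E] by blast
  have eq: "(R(Y := K)) P = R P" if "P \<in> N" for P using that Y by auto
  show ?thesis
  proof (rule root_modelI)
    fix P assume P: "P \<in> insert Y N"
    show "conn E ((R(Y := K)) P) \<and> (R(Y := K)) P \<subseteq> V \<and> (R(Y := K)) P \<inter> D = {}"
      using P K(1-3) root_modelD(1-3)[OF R, of P] by (cases "P = Y") simp_all
    show "b \<in> (R(Y := K)) P" if "a \<in> D" "b \<in> P" "(a, b) \<in> E" for a b
    proof (cases "P = Y")
      case True
      then show ?thesis using K(4) that by simp
    next
      case False
      then show ?thesis using root_modelD(4)[OF R, of P a b] that P by simp
    qed
    show "(R(Y := K)) P \<inter> (R(Y := K)) Q = {} \<and> touches E ((R(Y := K)) P) ((R(Y := K)) Q)"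
      if Q: "Q \<in> insert Y N" "P \<noteq> Q" for Q
    proof (cases "P = Y")
      case True
      then show ?thesis using Q KR[of Q] eq[of Q] by simp
    next
      case PY: False
      show ?thesis
      proof (cases "Q = Y")
        case True
        then show ?thesis using PY P KR'[of P] eq[of P] by simp
      next
        case False
        then show ?thesis using PY P Q root_modelD(5)[OF R, of P Q] by simp
      qed
    qed
  qed
qed

context tree_decomp
begin

text \<open>First a set \<open>Y0\<close> is found all of whose colourful leftover components are
  good, by a hitting set if \<open>card N = s\<close> and inside a single bag otherwise; then
  \<open>minimal_split\<close> shrinks it to \<open>Y\<close>. For a colourful component, goodness
  supplies a branch set for \<open>Y\<close>; for any other, the parts that it has lost do.\<close>

lemma new_part:
  assumes G: "pair_graph G" "V = pverts G" "E = parcs G" and free: "J_minor_free s t G" and t: "2 \<le> t"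
    and C: "conn E C" "C \<subseteq> V" and N: "finite N" "card N \<le> s"
    and NC: "\<And>P. P \<in> N \<Longrightarrow> touches E C P \<and> P \<inter> C = {}" and R: "root_model E V N C R"
  obtains Y M where "Y \<subseteq> C" "Y \<noteq> {}" "M \<subseteq> X" "card M \<le> t - 1" "Y \<subseteq> (\<Union>x\<in>M. W x)"
    "\<forall>D. component_of E (C - Y) D \<longrightarrow> card {P \<in> N. touches E D P} < s \<and>
       (\<exists>R'. root_model E V (insert Y {P \<in> N. touches E D P}) D R')"
proof -
  let ?col = "\<lambda>D. \<forall>P\<in>N. touches E D P"
  \<comment> \<open>The set \<open>K\<close> is designed as branch set of the new part: it is
    connected, outside \<open>D\<close>, contains all neighbours of \<open>D\<close> in
    \<open>C\<close>, and sees every old part.\<close>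
  let ?good = "\<lambda>D. \<exists>K. conn E K \<and> ?col K \<and> K \<subseteq> C - D \<and> (\<forall>a\<in>D. \<forall>b\<in>C - D. (a, b) \<in> E \<longrightarrow> b \<in> K)"
  have finC: "finite C" using C(2) G(1,2) unfolding pair_graph_iff by (metis finite_subset)
  have colC: "?col C" using NC by blast
  \<comment> \<open>Bundling \<open>card N < s\<close> with goodness treats both cases alike: when
    \<open>card N = s\<close>, no colourful component is left and the implication is
    vacuous.\<close>
  have "\<exists>Y0 M. Y0 \<subseteq> C \<and> M \<subseteq> X \<and> card M \<le> t - 1 \<and> Y0 \<subseteq> (\<Union>x\<in>M. W x) \<and>
      (\<forall>D. component_of E (C - Y0) D \<longrightarrow> ?col D \<longrightarrow> card N < s \<and> ?good D)"
  proof (cases "card N < s")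
    case True
    have mono: "?col S'" if "?col S" "S \<subseteq> S'" for S S' using that touches_mono by blast
    obtain z Y0 where Y0: "z \<in> X" "Y0 \<subseteq> C" "Y0 \<subseteq> W z"
      "\<forall>D. component_of E (C - Y0) D \<longrightarrow> ?col D \<longrightarrow> ?good D"
      by (rule single_bag_split[of C ?col, OF C colC mono])
    have "\<forall>D. component_of E (C - Y0) D \<longrightarrow> ?col D \<longrightarrow> card N < s \<and> ?good D"
      using Y0(4) True by simp
    moreover have "Y0 \<subseteq> (\<Union>x\<in>{z}. W x)" "{z} \<subseteq> X" "card {z} \<le> t - 1" using Y0(1,3) t by simp_all
    ultimately show ?thesis using Y0(2) by blast
  next
    case False
    then have Ns: "card N = s" using N(2) by simp
    let ?F = "{S. conn E S \<and> S \<subseteq> C \<and> ?col S}"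
    have tor: "\<exists>a\<in>S. \<exists>b\<in>R P. (a, b) \<in> parcs G" if "S \<in> ?F" "P \<in> N" for S P
    proof -
      obtain a b where "a \<in> S" "b \<in> P" "(a, b) \<in> E" using \<open>S \<in> ?F\<close> \<open>P \<in> N\<close> unfolding touches_def by blast
      moreover from this have "b \<in> R P" using root_modelD(4)[OF R \<open>P \<in> N\<close>, of a b] \<open>S \<in> ?F\<close> by blast
      ultimately show ?thesis using G(3) by blast
    qed
    \<comment> \<open>Disjoint connected colourful sets inside \<open>C\<close> together with the
      sets \<open>R P\<close> would be a model of a graph in \<open>J_class s t\<close>.\<close>
    have nopack: "\<not> (\<exists>\<S>\<subseteq>?F. finite \<S> \<and> card \<S> = t \<and> (\<forall>S\<in>\<S>. \<forall>S'\<in>\<S>. S \<noteq> S' \<longrightarrow> S \<inter> S' = {}))"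
    proof
      assume "\<exists>\<S>\<subseteq>?F. finite \<S> \<and> card \<S> = t \<and> (\<forall>S\<in>\<S>. \<forall>S'\<in>\<S>. S \<noteq> S' \<longrightarrow> S \<inter> S' = {})"
      then obtain SS where SS: "SS \<subseteq> ?F" "card SS = t" "\<forall>S\<in>SS. \<forall>S'\<in>SS. S \<noteq> S' \<longrightarrow> S \<inter> S' = {}"
        by blast
      show False
      proof (rule J_minor_free_no_model[OF G(1) free _ N(1) Ns, of R C SS])
        show "0 < t" using t by simp
        show "conn (parcs G) (R P) \<and> R P \<subseteq> pverts G" if "P \<in> N" for P
          using root_modelD(1,2)[OF R that] G(2,3) by simp
        show "R P \<inter> R Q = {} \<and> (\<exists>a\<in>R P. \<exists>b\<in>R Q. (a, b) \<in> parcs G)" if "P \<in> N" "Q \<in> N" "P \<noteq> Q" for P Q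
          using root_modelD(5)[OF R that] G(3) unfolding touches_def by simp
        show "conn (parcs G) C" "C \<subseteq> pverts G" using C G(2,3) by simp_all
        show "R P \<inter> C = {}" if "P \<in> N" for P using root_modelD(3)[OF R that] .
        show "card SS = t" by fact
        show "conn (parcs G) S \<and> S \<subseteq> C \<and> (\<forall>P\<in>N. \<exists>a\<in>S. \<exists>b\<in>R P. (a, b) \<in> parcs G)" if "S \<in> SS" for S
        proof -
          have S: "S \<in> ?F" using SS(1) that by blast
          have "\<forall>P\<in>N. \<exists>a\<in>S. \<exists>b\<in>R P. (a, b) \<in> parcs G" using tor[OF S] by simp
          then show ?thesis using S G(3) by simp
        qed
        show "S \<inter> S' = {}" if "S \<in> SS" "S' \<in> SS" "S \<noteq> S'" for S S' using SS(3) that by simp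
      qed
    qed
    have FV: "conn E S \<and> S \<subseteq> V" if "S \<in> ?F" for S using that C(2) by blast
    have "\<exists>M\<subseteq>X. card M < t \<and> (\<forall>S\<in>?F. S \<inter> (\<Union>x\<in>M. W x) \<noteq> {})"
      by (rule disjE[OF packing_or_hitting[of ?F t, OF FV]]; (erule notE[OF nopack] | assumption))
    then obtain M where M: "M \<subseteq> X" "card M < t" "\<forall>S\<in>?F. S \<inter> (\<Union>x\<in>M. W x) \<noteq> {}"
      by (elim exE conjE)
    let ?Y = "C \<inter> (\<Union>x\<in>M. W x)"
    have ncol: "\<not> ?col D" if D: "component_of E (C - ?Y) D" for D
    proof
      assume "?col D"
      then have "D \<in> ?F" using component_ofD(1,2)[OF D] by blast
      then show False using M(3) component_ofD(1)[OF D] by blast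
    qed
    have "\<forall>D. component_of E (C - ?Y) D \<longrightarrow> ?col D \<longrightarrow> card N < s \<and> ?good D"
      by (intro allI impI) (erule notE[OF ncol])
    moreover have "?Y \<subseteq> C" "?Y \<subseteq> (\<Union>x\<in>M. W x)" "card M \<le> t - 1" using M(2) by auto
    ultimately show ?thesis using M(1) by blast
  qed
  then obtain Y0 M where Y0: "Y0 \<subseteq> C" "M \<subseteq> X" "card M \<le> t - 1" "Y0 \<subseteq> (\<Union>x\<in>M. W x)"
    "\<forall>D. component_of E (C - Y0) D \<longrightarrow> ?col D \<longrightarrow> card N < s \<and> ?good D"
    by blast
  \<comment> \<open>A connected \<open>K\<close> is nonempty and cannot lie in \<open>C - C\<close>;
    this is the hypothesis of \<open>minimal_split\<close> that makes the new part nonempty.\<close>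
  have "\<not> (card N < s \<and> ?good C)" using conn_nonempty by blast
  with Y0(1,5) obtain Y where Y: "Y \<subseteq> Y0" "Y \<noteq> {}"
    and colour: "\<forall>D. component_of E (C - Y) D \<longrightarrow> ?col D \<longrightarrow> card N < s \<and> ?good D"
    and miss: "\<forall>D Z. component_of E (C - Y) D \<longrightarrow> \<not> ?col D \<longrightarrow> component_of E (C - D) Z \<longrightarrow>
       (\<exists>P\<in>N. \<not> touches E D P \<and> touches E Z P)"
    by (rule minimal_split[OF sym_E C(1) finC colC])
  have YC: "Y \<subseteq> C" using Y(1) Y0(1) by blast
  then have YN: "Y \<notin> N" using NC Y(2) by blast
  show thesis
  proof (rule that[OF YC Y(2) Y0(2,3)])
    show "Y \<subseteq> (\<Union>x\<in>M. W x)" using Y(1) Y0(4) by blast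
    have "card {P \<in> N. touches E D P} < s \<and> (\<exists>R'. root_model E V (insert Y {P \<in> N. touches E D P}) D R')"
      if D: "component_of E (C - Y) D" for D
    proof -
      note Dd = component_ofD[OF D]
      let ?N = "{P \<in> N. touches E D P}"
      have RD: "root_model E V ?N D R" by (rule root_model_subset[OF R]) (use Dd(1) in auto)
      have YN': "Y \<notin> ?N" using YN by blast
      show "card ?N < s \<and> (\<exists>R'. root_model E V (insert Y ?N) D R')"
      proof (cases "?col D")
        case True
        then have N': "?N = N" by blast
        obtain K where K: "card N < s" "conn E K" "?col K" "K \<subseteq> C - D"
            "\<forall>a\<in>D. \<forall>b\<in>C - D. (a, b) \<in> E \<longrightarrow> b \<in> K"
          using colour D True by blast
        have "root_model E V (insert Y ?N) D (R(Y := K))"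
        proof (rule root_model_insert[OF sym_E RD YN' K(2)])
          show "K \<subseteq> V" "K \<inter> D = {}" using K(4) C(2) by blast+
          show "b \<in> K" if "a \<in> D" "b \<in> Y" "(a, b) \<in> E" for a b
            using K(5) that YC Dd(1) by blast
          show "K \<inter> R P = {} \<and> touches E K (R P)" if "P \<in> ?N" for P
          proof -
            have P: "P \<in> N" using that by blast
            have "K \<inter> R P = {}" using root_modelD(3)[OF R P] K(4) by blast
            moreover obtain a b where "a \<in> K" "b \<in> P" "(a, b) \<in> E" using K(3) P unfolding touches_def by blast
            moreover from this have "b \<in> R P" using root_modelD(4)[OF R P, of a b] K(4) by blast
            ultimately show ?thesis unfolding touches_def by blast
          qed
        qed
        then show ?thesis using N' K(1) by auto
      next
        case False
        \<comment> \<open>The parts not seen by \<open>D\<close> link all of \<open>C - D\<close> to the remaining parts.\<close>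
      let ?J = "N - ?N"
        let ?K = "(C - D) \<union> (\<Union>P\<in>?J. R P)"
        obtain P0 where P0: "P0 \<in> ?J" using False by blast
        \<comment> \<open>By minimality of \<open>Y\<close>, each component of \<open>C - D\<close>
          sees a part that \<open>D\<close> does not see, and so its branch set.\<close>
        have comp: "\<exists>P\<in>?J. \<exists>a\<in>Z. \<exists>b\<in>R P. (a, b) \<in> E" if Z: "component_of E (C - D) Z" for Z
        proof -
          obtain P where P: "P \<in> N" "\<not> touches E D P" "touches E Z P" using miss D False Z by blast
          then obtain a b where ab: "a \<in> Z" "b \<in> P" "(a, b) \<in> E" unfolding touches_def by blast
          moreover have "b \<in> R P" using root_modelD(4)[OF R P(1), of a b] ab component_ofD(1)[OF Z] by blast
          ultimately show ?thesis using P(1,2) by blast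
        qed
        \<comment> \<open>A part has been lost, so there is room for \<open>Y\<close> even when
          \<open>card N = s\<close>.\<close>
        have "card ?N < card N" by (rule psubset_card_mono[OF N(1)]) (use False in blast)
        then have "card ?N < s" using N(2) by simp
        moreover have "root_model E V (insert Y ?N) D (R(Y := ?K))"
        proof (rule root_model_insert[OF sym_E RD YN'])
          show "conn E ?K"
          proof (rule connI)
            have "R P0 \<noteq> {}" using root_modelD(1)[OF R, of P0] P0 conn_nonempty by blast
            then show "?K \<noteq> {}" using P0 by blast
            fix A assume A: "A \<subseteq> ?K" "A \<noteq> {}" and cl: "\<And>a b. \<lbrakk>a \<in> A; b \<in> ?K; (a, b) \<in> E\<rbrakk> \<Longrightarrow> b \<in> A"
            have AR: "R P \<subseteq> A" if "P \<in> ?J" "A \<inter> R P \<noteq> {}" for P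
              by (rule connD[OF root_modelD(1)[OF R]]) (use that cl in blast)+
            have AZ: "Z \<subseteq> A" if "component_of E (C - D) Z" "A \<inter> Z \<noteq> {}" for Z
              by (rule connD[OF component_ofD(2)[OF that(1)] that(2)])
                (use component_ofD(1)[OF that(1)] cl in blast)
            have Z: "\<exists>Z. component_of E (C - D) Z \<and> x \<in> Z" if "x \<in> C - D" for x
              using component_of_exists[OF sym_E that] by blast
            obtain x where x: "x \<in> A" using A(2) by blast
            \<comment> \<open>A closed set contains one branch set of \<open>?J\<close> entirely,
              then all of them because they are pairwise adjacent, and finally every component of
              \<open>C - D\<close>, each being attached to one of them.\<close>
            have "\<exists>P\<in>?J. R P \<subseteq> A"
            proof (cases "x \<in> C - D")
              case True
              then obtain Z where Zx: "component_of E (C - D) Z" "x \<in> Z" using Z by blast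
              then have ZA: "Z \<subseteq> A" using AZ x by blast
              obtain P a b where P: "P \<in> ?J" "a \<in> Z" "b \<in> R P" "(a, b) \<in> E" using comp[OF Zx(1)] by blast
              then have "b \<in> A" using cl[of a b] ZA by blast
              then show ?thesis using AR[OF P(1)] P(1,3) by blast
            next
              case False
              then obtain P where P: "P \<in> ?J" "x \<in> R P" using A(1) x by blast
              then show ?thesis using AR[OF P(1)] x by blast
            qed
            then obtain P1 where P1: "P1 \<in> ?J" "R P1 \<subseteq> A" by blast
            have all: "R Q \<subseteq> A" if Q: "Q \<in> ?J" for Q
            proof (cases "Q = P1")
              case False
              then have "touches E (R P1) (R Q)" using root_modelD(5)[OF R, of P1 Q] P1(1) Q by blast
              then obtain a b where "a \<in> R P1" "b \<in> R Q" "(a, b) \<in> E" unfolding touches_def by blast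
              then have "b \<in> A \<inter> R Q" using cl[of a b] P1(2) Q by blast
              then show ?thesis using AR[OF Q] by blast
            qed (use P1 in simp)
            have "x \<in> A" if x: "x \<in> C - D" for x
            proof -
              obtain Z where Zx: "component_of E (C - D) Z" "x \<in> Z" using Z[OF x] by blast
              obtain P a b where P: "P \<in> ?J" "a \<in> Z" "b \<in> R P" "(a, b) \<in> E" using comp[OF Zx(1)] by blast
              have "(b, a) \<in> E" using P(4) sym_E by (auto dest: symD)
              then have "a \<in> A" using cl[of b a] all[OF P(1)] P(2,3) component_ofD(1)[OF Zx(1)] by blast
              then show ?thesis using AZ[OF Zx(1)] P(2) Zx(2) by blast
            qed
            then show "?K \<subseteq> A" using all by blast
          qed
          show "?K \<subseteq> V" using C(2) root_modelD(2)[OF R] by blast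
          show "?K \<inter> D = {}" using root_modelD(3)[OF R] Dd(1) by blast
          show "b \<in> ?K" if "a \<in> D" "b \<in> Y" "(a, b) \<in> E" for a b
            using that YC Dd(1) by blast
          show "?K \<inter> R P = {} \<and> touches E ?K (R P)" if P: "P \<in> ?N" for P
          proof
            have "R Q \<inter> R P = {}" if "Q \<in> ?J" for Q using root_modelD(5)[OF R, of Q P] that P by blast
            moreover have "R P \<inter> C = {}" using root_modelD(3)[OF R, of P] P by blast
            ultimately show "?K \<inter> R P = {}" by blast
            \<comment> \<open>Adjacency to the parts still seen is inherited from the old clique
              through \<open>R P0\<close>, which \<open>?K\<close> has absorbed.\<close>
            have "touches E (R P0) (R P)" using root_modelD(5)[OF R, of P0 P] P0 P by blast
            then show "touches E ?K (R P)" by (rule touches_mono) (use P0 in blast)+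
          qed
        qed
        ultimately show ?thesis by blast
      qed
    qed
    then show "\<forall>D. component_of E (C - Y) D \<longrightarrow> card {P \<in> N. touches E D P} < s \<and>
       (\<exists>R'. root_model E V (insert Y {P \<in> N. touches E D P}) D R')" by blast
  qed
qed

end

section \<open>Building the partition\<close>

text \<open>All neighbours of the new vertex \<open>Y\<close> lie in the one bag \<open>B x\<close>.
  A leaf at \<open>x\<close> with bag \<open>insert Y N\<close> covers the new edges and extends the
  subtrees of the members of \<open>N\<close> by a node adjacent to them.\<close>

lemma tree_decomposition_add_leaf:
  assumes H: "tree_decomposition H T B" and x: "x \<in> pverts T" "N \<subseteq> B x" and l: "l \<notin> pverts T"
    and Y: "Y \<notin> pverts H" and H': "pverts H' = insert Y (pverts H)"
      "parcs H' \<subseteq> parcs H \<union> {Y} \<times> N \<union> N \<times> {Y}"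
  shows "tree_decomposition H' \<lparr>pverts = insert l (pverts T), parcs = parcs T \<union> {(x, l), (l, x)}\<rparr>
    (B(l := insert Y N))"
proof -
  let ?T = "\<lparr>pverts = insert l (pverts T), parcs = parcs T \<union> {(x, l), (l, x)}\<rparr>"
  let ?B = "B(l := insert Y N)"
  have T: "graph_tree T" "\<forall>x\<in>pverts T. B x \<subseteq> pverts H"
    "\<forall>v\<in>pverts H. connected (with_proj T \<restriction> {x \<in> pverts T. v \<in> B x})"
    "\<forall>(u, v)\<in>parcs H. \<exists>x\<in>pverts T. u \<in> B x \<and> v \<in> B x"
    using H unfolding tree_decomposition_def by blast+
  have T': "graph_tree ?T" by (rule graph_tree_add_leaf[OF T(1) x(1) l])
  have pg: "pair_graph T" "pair_graph ?T" using T(1) T' unfolding graph_tree_iff by blast+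
  have symT: "sym (parcs ?T)" using pg(2) unfolding pair_graph_iff by blast
  have NH: "N \<subseteq> pverts H" using x T(2) by blast
  have "conn (parcs ?T) {y \<in> pverts ?T. v \<in> ?B y}" if v: "v \<in> pverts H'" for v
  proof (cases "v = Y")
    case True
    have "{y \<in> pverts ?T. v \<in> ?B y} = {l}" using T(2) Y l True by auto
    then show ?thesis by (simp add: conn_singleton)
  next
    case False
    then have vH: "v \<in> pverts H" using v H'(1) by blast
    let ?S = "{y \<in> pverts T. v \<in> B y}"
    have "conn (parcs T) ?S" using T(3) vH conn_induce_subgraph_iff[OF pg(1), of ?S] by auto
    then have S: "conn (parcs ?T) ?S" using conn_cong[of ?S "parcs T" "parcs ?T"] l by auto
    show ?thesis
    proof (cases "v \<in> N")
      case True
      have "{y \<in> pverts ?T. v \<in> ?B y} = insert l ?S" using True l by auto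
      moreover have "conn (parcs ?T) (insert l ?S)"
        by (rule conn_insert[OF symT S, of x]) (use x True in auto)
      ultimately show ?thesis by simp
    next
      case vN: False
      have "{y \<in> pverts ?T. v \<in> ?B y} = ?S" using vN False l by auto
      then show ?thesis using S by simp
    qed
  qed
  then have "\<forall>v\<in>pverts H'. connected (with_proj ?T \<restriction> {y \<in> pverts ?T. v \<in> ?B y})"
    by (intro ballI) (subst conn_induce_subgraph_iff[OF pg(2)]; blast)
  moreover have "\<forall>y\<in>pverts ?T. ?B y \<subseteq> pverts H'" using T(2) NH H'(1) by auto
  moreover have "\<exists>y\<in>pverts ?T. u \<in> ?B y \<and> v \<in> ?B y" if uv: "(u, v) \<in> parcs H'" for u v
  proof (cases "(u, v) \<in> parcs H")
    case True
    then obtain y where "y \<in> pverts T" "u \<in> B y" "v \<in> B y" using T(4) by blast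
    then show ?thesis using l by (intro bexI[of _ y]) auto
  next
    case False
    then have "u \<in> insert Y N \<and> v \<in> insert Y N" using H'(2) uv by blast
    then show ?thesis by (intro bexI[of _ l]) auto
  qed
  ultimately show ?thesis unfolding tree_decomposition_def using T' by blast
qed

context tree_decomp
begin

definition touching :: "'a set set \<Rightarrow> 'a set \<Rightarrow> 'a set set" where
  "touching \<P> D = {P \<in> \<P>. touches E D P}"

text \<open>The invariant of the construction. Bags of size \<open>Suc s\<close> mean width
  \<open>s\<close>. The last clause prepares the next part: its neighbours will lie in a common bag,
  where a leaf can be hung, and they carry a clique model outside the component.\<close>

definition partial_partition ::
  "nat \<Rightarrow> nat \<Rightarrow> 'a set set \<Rightarrow> nat pair_pre_digraph \<Rightarrow> (nat \<Rightarrow> 'a set set) \<Rightarrow> bool" where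
  "partial_partition s t \<P> T B \<longleftrightarrow>
     (\<forall>P\<in>\<P>. P \<subseteq> V \<and> (\<exists>M\<subseteq>X. card M \<le> t - 1 \<and> P \<subseteq> (\<Union>x\<in>M. W x))) \<and>
     (\<forall>P\<in>\<P>. \<forall>Q\<in>\<P>. P \<noteq> Q \<longrightarrow> P \<inter> Q = {}) \<and>
     tree_decomposition (branch_graph E \<P> (\<lambda>P. P)) T B \<and>
     (\<forall>x\<in>pverts T. card (B x) \<le> Suc s) \<and>
     (\<forall>D. component_of E (V - \<Union>\<P>) D \<longrightarrow>
        card (touching \<P> D) \<le> s \<and> (\<exists>x\<in>pverts T. touching \<P> D \<subseteq> B x) \<and>
        (\<exists>R. root_model E V (touching \<P> D) D R))"

text \<open>A tree has at least one node, so the construction starts from a single empty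
  bag.\<close>

lemma partial_partition_empty: "partial_partition s t {} \<lparr>pverts = {0}, parcs = {}\<rparr> (\<lambda>_. {})"
proof -
  have "graph_tree \<lparr>pverts = {0 :: nat}, parcs = {}\<rparr>"
    unfolding graph_tree_iff pair_graph_iff
    by (auto simp: conn_singleton single_attach_def sym_def irrefl_def)
  then show ?thesis
    unfolding partial_partition_def tree_decomposition_def branch_graph_def touching_def
    by (auto simp: root_model_def)
qed

text \<open>The new part \<open>Y\<close> is cut from one component \<open>C\<close> of the
  uncovered vertices. Components away from \<open>C\<close> keep their data, and those inside
  \<open>C - Y\<close> get theirs from \<open>new_part\<close> and the new leaf.\<close>

lemma partial_partition_step:
  assumes G: "pair_graph G" "V = pverts G" "E = parcs G" and free: "J_minor_free s t G" and t: "2 \<le> t"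
    and inv: "partial_partition s t \<P> T B" and v: "v \<in> V - \<Union>\<P>"
  shows "\<exists>Y T' B'. Y \<noteq> {} \<and> Y \<subseteq> V - \<Union>\<P> \<and> partial_partition s t (insert Y \<P>) T' B'"
proof -
  let ?U = "V - \<Union>\<P>"
  have parts: "\<forall>P\<in>\<P>. P \<subseteq> V \<and> (\<exists>M\<subseteq>X. card M \<le> t - 1 \<and> P \<subseteq> (\<Union>x\<in>M. W x))"
    and disj: "\<forall>P\<in>\<P>. \<forall>Q\<in>\<P>. P \<noteq> Q \<longrightarrow> P \<inter> Q = {}"
    and td: "tree_decomposition (branch_graph E \<P> (\<lambda>P. P)) T B"
    and width: "\<forall>x\<in>pverts T. card (B x) \<le> Suc s"
    and comps: "\<And>D. component_of E ?U D \<Longrightarrow>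
        card (touching \<P> D) \<le> s \<and> (\<exists>x\<in>pverts T. touching \<P> D \<subseteq> B x) \<and>
        (\<exists>R. root_model E V (touching \<P> D) D R)"
    using inv unfolding partial_partition_def by simp_all
  have finV: "finite V" using G(1,2) unfolding pair_graph_iff by simp
  have finP: "finite \<P>" by (rule finite_subset[of _ "Pow V"]) (use parts finV in auto)
  obtain C where C: "component_of E ?U C" using component_of_exists[OF sym_E v] by blast
  note Cd = component_ofD[OF C]
  let ?N = "touching \<P> C"
  obtain x R where x: "x \<in> pverts T" "?N \<subseteq> B x" and cardN: "card ?N \<le> s" and R: "root_model E V ?N C R"
    using comps[OF C] by blast
  have finN: "finite ?N" using finP unfolding touching_def by simp
  have NC: "touches E C P \<and> P \<inter> C = {}" if "P \<in> ?N" for P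
    using that Cd(1) unfolding touching_def by blast
  have CV: "C \<subseteq> V" using Cd(1) by blast
  obtain Y M where Y: "Y \<subseteq> C" "Y \<noteq> {}" and M: "M \<subseteq> X" "card M \<le> t - 1" "Y \<subseteq> (\<Union>x\<in>M. W x)"
    and split: "\<forall>D. component_of E (C - Y) D \<longrightarrow> card {P \<in> ?N. touches E D P} < s \<and>
       (\<exists>R'. root_model E V (insert Y {P \<in> ?N. touches E D P}) D R')"
    by (rule new_part[OF G free t Cd(2) CV finN cardN NC R])
  let ?P = "insert Y \<P>"
  have YU: "Y \<subseteq> ?U" using Y(1) Cd(1) by blast
  have YP: "Y \<notin> \<P>" using YU Y(2) by blast
  have finT: "finite (pverts T)"
    using td unfolding tree_decomposition_def graph_tree_iff pair_graph_iff by blast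
  obtain l where l: "l \<notin> pverts T" using ex_new_if_finite[OF _ finT] by auto
  let ?T = "\<lparr>pverts = insert l (pverts T), parcs = parcs T \<union> {(x, l), (l, x)}\<rparr>"
  let ?B = "B(l := insert Y ?N)"
  have td': "tree_decomposition (branch_graph E ?P (\<lambda>P. P)) ?T ?B"
  proof (rule tree_decomposition_add_leaf[OF td x l])
    show "Y \<notin> pverts (branch_graph E \<P> (\<lambda>P. P))" using YP by (simp add: branch_graph_def)
    show "pverts (branch_graph E ?P (\<lambda>P. P)) = insert Y (pverts (branch_graph E \<P> (\<lambda>P. P)))"
      by (simp add: branch_graph_def)
    \<comment> \<open>Since \<open>Y\<close> lies in \<open>C\<close>, a part adjacent to
      \<open>Y\<close> is adjacent to \<open>C\<close>, so all neighbours of \<open>Y\<close> are in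
      the new bag.\<close>
    have "P \<in> ?N" if "P \<in> \<P>" "a \<in> Y" "b \<in> P" "(a, b) \<in> E" for P a b
      using that Y(1) unfolding touching_def touches_def by blast
    moreover have "(b, a) \<in> E" if "(a, b) \<in> E" for a b using that sym_E by (auto dest: symD)
    ultimately show "parcs (branch_graph E ?P (\<lambda>P. P)) \<subseteq>
        parcs (branch_graph E \<P> (\<lambda>P. P)) \<union> {Y} \<times> ?N \<union> ?N \<times> {Y}"
      unfolding branch_graph_def by fastforce
  qed
  have width': "\<forall>y\<in>pverts ?T. card (?B y) \<le> Suc s"
    using width cardN finN by (auto simp: card_insert_if)
  have comps': "card (touching ?P D) \<le> s \<and> (\<exists>y\<in>pverts ?T. touching ?P D \<subseteq> ?B y) \<and>
      (\<exists>R. root_model E V (touching ?P D) D R)" if D: "component_of E (V - \<Union>?P) D" for D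
  proof -
    note Dd = component_ofD[OF D]
    have DU: "D \<subseteq> ?U" using Dd(1) by blast
    show ?thesis
    proof (cases "D \<inter> C = {}")
      case True
      \<comment> \<open>\<open>C\<close> is a component, so a set disjoint from it has no edge into
        \<open>Y\<close>.\<close>
      have no: "b \<notin> Y" if "a \<in> D" "(a, b) \<in> E" for a b
      proof
        assume "b \<in> Y"
        then have "a \<in> C" using Cd(3)[of b a] Y(1) that DU sym_E by (auto dest: symD)
        then show False using that True by blast
      qed
      have "b \<in> D" if "a \<in> D" "b \<in> ?U" "(a, b) \<in> E" for a b
        using Dd(3)[of a b] no[of a b] that by simp
      then have "component_of E ?U D" unfolding component_of_def using DU Dd(2) by simp
      from comps[OF this] obtain y R' where
        *: "card (touching \<P> D) \<le> s" "y \<in> pverts T" "touching \<P> D \<subseteq> B y" "root_model E V (touching \<P> D) D R'"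
        by blast
      have "touching ?P D = touching \<P> D" unfolding touching_def touches_def using no by blast
      moreover have "B y = ?B y" using *(2) l by auto
      ultimately show ?thesis using * by (metis insertI2 pair_pre_digraph.select_convs(1))
    next
      case False
      have DC: "D \<subseteq> C" by (rule conn_subset_component[OF C Dd(2) DU False])
      have "b \<in> D" if "a \<in> D" "b \<in> C - Y" "(a, b) \<in> E" for a b
        using Dd(3)[of a b] Cd(1) that by auto
      moreover have "D \<subseteq> C - Y" using DC Dd(1) by auto
      ultimately have "component_of E (C - Y) D" unfolding component_of_def using Dd(2) by simp
      with split obtain R' where *: "card {P \<in> ?N. touches E D P} < s"
          "root_model E V (insert Y {P \<in> ?N. touches E D P}) D R'"
        by blast
      have sub: "touching ?P D \<subseteq> insert Y {P \<in> ?N. touches E D P}"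
        using DC unfolding touching_def touches_def by blast
      have fin: "finite {P \<in> ?N. touches E D P}" using finN by simp
      have "card (touching ?P D) \<le> card (insert Y {P \<in> ?N. touches E D P})"
        by (rule card_mono[OF _ sub]) (use fin in simp)
      \<comment> \<open>The strict bound from \<open>new_part\<close> leaves one place for
        \<open>Y\<close> itself.\<close>
      also have "\<dots> \<le> s" using *(1) fin by (simp add: card_insert_if)
      finally have "card (touching ?P D) \<le> s" .
      moreover have "touching ?P D \<subseteq> ?B l" using sub by auto
      moreover have "root_model E V (touching ?P D) D R'" by (rule root_model_subset[OF *(2) sub]) simp
      ultimately show ?thesis by auto
    qed
  qed
  have "partial_partition s t ?P ?T ?B"
    unfolding partial_partition_def
  proof (intro conjI)
    show "\<forall>P\<in>?P. P \<subseteq> V \<and> (\<exists>M\<subseteq>X. card M \<le> t - 1 \<and> P \<subseteq> (\<Union>x\<in>M. W x))"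
      using parts M YU by blast
    show "\<forall>P\<in>?P. \<forall>Q\<in>?P. P \<noteq> Q \<longrightarrow> P \<inter> Q = {}" using disj YU by blast
  qed (use td' width' comps' in blast)+
  then show ?thesis using Y(2) YU by blast
qed

text \<open>Each new part is nonempty and uncovered before, so the number of uncovered vertices
  decreases.\<close>

lemma partition_exists:
  assumes G: "pair_graph G" "V = pverts G" "E = parcs G" and free: "J_minor_free s t G" and t: "2 \<le> t"
    and "partial_partition s t \<P> T B"
  shows "\<exists>\<P>' T' B'. partial_partition s t \<P>' T' B' \<and> V \<subseteq> \<Union>\<P>'"
  using assms(6)
proof (induction "card (V - \<Union>\<P>)" arbitrary: \<P> T B rule: less_induct)
  case less
  show ?case
  proof (cases "V \<subseteq> \<Union>\<P>")
    case True
    then show ?thesis using less.prems by blast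
  next
    case False
    then obtain v where "v \<in> V - \<Union>\<P>" by blast
    from partial_partition_step[OF G free t less.prems this] obtain Y T' B' where
      Y: "Y \<noteq> {}" "Y \<subseteq> V - \<Union>\<P>" "partial_partition s t (insert Y \<P>) T' B'" by blast
    have "finite V" using G(1,2) unfolding pair_graph_iff by simp
    then have "card (V - \<Union>(insert Y \<P>)) < card (V - \<Union>\<P>)"
      by (intro psubset_card_mono) (use Y(1,2) in auto)
    then show ?thesis using less.hyps Y(3) by blast
  qed
qed

end

theorem theorem12:
  fixes s t :: nat
    and G :: "'a pair_pre_digraph"
    and T :: "'b pair_pre_digraph"
    and W :: "'b \<Rightarrow> 'a set"
  assumes "2 \<le> s" and "2 \<le> t"
    and "pair_graph G"
    and "J_minor_free s t G"
    and "tree_decomposition G T W"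
  shows "\<exists>H. graph_partition G H \<and> partition_bag_width T W H \<le> t - 1 \<and> treewidth H \<le> s"
proof -
  have T: "graph_tree T" and edge: "\<forall>(u, v)\<in>parcs G. \<exists>x\<in>pverts T. u \<in> W x \<and> v \<in> W x"
    and bag: "\<forall>v\<in>pverts G. connected (with_proj T \<restriction> {x \<in> pverts T. v \<in> W x})"
    using assms(5) unfolding tree_decomposition_def by blast+
  have Tp: "pair_graph T" "conn (parcs T) (pverts T)" "single_attach (parcs T)"
    using T unfolding graph_tree_iff by blast+
  \<comment> \<open>Any node can be the root; there is one because a connected tree is
    nonempty.\<close>
  obtain r where r: "r \<in> pverts T" using conn_nonempty[OF Tp(2)] by blast
  interpret tree_decomp "pverts G" "parcs G" "pverts T" "parcs T" W r
  proof
    show "sym (parcs G)" using assms(3) unfolding pair_graph_iff by blast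
    show "finite (pverts T)" "sym (parcs T)" using Tp(1) unfolding pair_graph_iff by blast+
    show "conn (parcs T) {x \<in> pverts T. v \<in> W x}" if "v \<in> pverts G" for v
      using bag that conn_induce_subgraph_iff[OF Tp(1), of "{x \<in> pverts T. v \<in> W x}"] by auto
    show "\<exists>x\<in>pverts T. u \<in> W x \<and> v \<in> W x" if "(u, v) \<in> parcs G" for u v using edge that by blast
  qed (use Tp r in blast)+
  obtain \<P> T' B where inv: "partial_partition s t \<P> T' B" and cover: "pverts G \<subseteq> \<Union>\<P>"
    using partition_exists[OF assms(3) refl refl assms(4,2) partial_partition_empty] by blast
  have parts: "\<forall>P\<in>\<P>. P \<subseteq> pverts G \<and> (\<exists>M\<subseteq>pverts T. card M \<le> t - 1 \<and> P \<subseteq> (\<Union>x\<in>M. W x))"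
    and disj: "\<forall>P\<in>\<P>. \<forall>Q\<in>\<P>. P \<noteq> Q \<longrightarrow> P \<inter> Q = {}"
    and td: "tree_decomposition (branch_graph (parcs G) \<P> (\<lambda>P. P)) T' B"
    and width: "\<forall>x\<in>pverts T'. card (B x) \<le> Suc s"
    using inv unfolding partial_partition_def by simp_all
  \<comment> \<open>The parts index themselves, so the branch graph joins two parts exactly when an
    edge of \<open>G\<close> runs between them.\<close>
  let ?H = "branch_graph (parcs G) \<P> (\<lambda>P. P)"
  have finP: "finite \<P>"
    by (rule finite_subset[of _ "Pow (pverts G)"]) (use parts assms(3) in \<open>auto simp: pair_graph_iff\<close>)
  have "pair_graph ?H" by (rule pair_graph_branch_graph[OF finP sym_E])
  then have "graph_partition G ?H"
    unfolding graph_partition_def branch_graph_def using parts disj cover by auto blast+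
  moreover have "set_bag_width T W P \<le> t - 1" if "P \<in> \<P>" for P
  proof -
    obtain M where M: "M \<subseteq> pverts T" "card M \<le> t - 1" "P \<subseteq> (\<Union>x\<in>M. W x)"
      using bspec[OF parts \<open>P \<in> \<P>\<close>] by (elim conjE exE)
    have "\<exists>N\<subseteq>pverts T. card N = card M \<and> P \<subseteq> (\<Union>x\<in>N. W x)"
      by (intro exI[of _ M] conjI refl M(1,3))
    then have "set_bag_width T W P \<le> card M" unfolding set_bag_width_def by (rule Least_le)
    then show ?thesis using M(2) by simp
  qed
  then have "partition_bag_width T W ?H \<le> t - 1"
    unfolding partition_bag_width_def branch_graph_def using finP by auto
  moreover have "treewidth ?H \<le> s"
  proof -
    have T': "finite (pverts T')" "pverts T' \<noteq> {}"
      using td conn_nonempty unfolding tree_decomposition_def graph_tree_iff pair_graph_iff by blast+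
    have "treewidth ?H \<le> decomposition_width T' B"
      unfolding treewidth_def by (rule Least_le) (use td in blast)
    also have "\<dots> \<le> s"
    proof -
      \<comment> \<open>Bags have at most \<open>s + 1\<close> members, and
        \<open>decomposition_width\<close> subtracts one.\<close>
      have "Max ((\<lambda>x. card (B x)) ` pverts T') \<le> Suc s" using T' width by (subst Max_le_iff) auto
      then show ?thesis unfolding decomposition_width_def by simp
    qed
    finally show ?thesis .
  qed
  ultimately show ?thesis by blast
qed

end
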